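(* Let $N\ge 3$ and let $(A,B)\in\mathcal P_N$ be a matrix pair with an upper Hessenberg matrix $A=V-\mathbf z\mathbf w^*\in\mathcal H_N$ and an upper triangular invertible matrix $B=U-\mathbf p\mathbf q^*\in\mathcal T_N$, where $V\in\mathcal V_N$ and $U\in\mathcal U_N$ are real orthogonal matrices and $\mathbf z,\mathbf w,\mathbf p,\mathbf q\in\mathbb R^N$. Let $p(z)=\alpha+\beta z+\gamma z^2\in\mathbb R[z]$ be a polynomial of degree at most $2$. Let $Q_1,\dots,Q_{N-2}$ and $Z_1,\dots,Z_{N-2}$ ($3\times 3$ real orthogonal matrices) and $Q_{N-1},Z_{N-1}$ ($2\times2$ real Givens rotations) be generated from these data by the double-shift procedure described in the context, and set $$Q=\tilde Q_1\tilde Q_2\cdots\tilde Q_{N-1},\qquad Z=\tilde Z_1\tilde Z_2\cdots\tilde Z_{N-1},$$ where $\tilde Q_i=I_{i-1}\oplus Q_i\oplus I_{N-i-2}$ and $\tilde Z_i=I_{i-1}\oplus Z_i\oplus I_{N-i-2}$ for $i=1,\dots,N-2$, and $\tilde Q_{N-1}=I_{N-2}\oplus Q_{N-1}$, $\tilde Z_{N-1}=I_{N-2}\oplus Z_{N-1}$. Then $A_1=Q^*AZ$ is upper Hessenberg, $B_1=Q^*BZ$ is upper triangular, and moreover $Q^*\,p(AB^{-1})\,\mathbf e_1=\tau\,\mathbf e_1$ for a suitable scalar $\tau\in\mathbb R$.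
   Context: All matrices are real, $^*$ denotes the transpose, $\mathbf e_1$ is the first standard basis vector of $\mathbb R^N$, $I_m$ is the $m\times m$ identity ($I_0$ is empty), $\oplus$ is the block diagonal sum, and MATLAB index notation $M(a\colon b,c\colon d)$ is used for submatrices. The symbol $\times$ denotes an unspecified entry or block. Entries of vectors are written $\mathbf z=(z(i))_{i=1}^N$, $\mathbf w=(w(i))_{i=1}^N$, $\mathbf p=(p(i))_{i=1}^N$, $\mathbf q=(q(i))_{i=1}^N$ (not to be confused with the polynomial $p(z)$). **Classes.** - $\mathcal H_N$: upper Hessenberg matrices $A\in\mathbb R^{N\times N}$ of the form $A=V-\mathbf z\mathbf w^*$ with $V$ orthogonal and $\mathbf z,\mathbf w\in\mathbb R^N$. - $\mathcal V_N$: orthogonal matrices $V\in\mathbb R^{N\times N}$ for which there are vectors $\mathbf z,\mathbf w$ such that $V-\mathbf z\mathbf w^*$ is upper Hessenberg. - $\mathcal T_N$: upper triangular matrices $B\in\mathbb R^{N\times N}$ of the form $B=U-\mathbf p\mathbf q^*$ with $U$ orthogonal and $\mathbf p,\mathbf q\in\mathbb R^N$. - $\mathcal U_N$: orthogonal matrices $U\in\mathbb R^{N\times N}$ for which there are vectors $\mathbf p,\mathbf q$ such that $U-\mathbf p\mathbf q^*$ is upper triangular. - $\mathcal P_N$: pairs $(A,B)$ with $A\in\mathcal H_N$ and $B\in\mathcal T_N$. **Input data of the procedure.** - The subdiagonal entries $\sigma^A_k=A(k+1,k)$, $k=1,\dots,N-1$. - Upper triangular generators of $V$ with orders $r^V_k$: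 matrices $g_V(i)$ ($1\times r^V_i$), $h_V(i)$ ($r^V_i\times 1$), $i=1,\dots,N$, and $b_V(k)$ ($r^V_k\times r^V_{k+1}$), $k=1,\dots,N-1$, such that $V(i,j)=g_V(i)\,b_V(i)b_V(i+1)\cdots b_V(j-1)\,h_V(j)$ for $1\le i\le j\le N$ (the product of $b_V$'s is the identity if $i=j$). - The diagonal entries $d_B(k)=B(k,k)$, $k=1,\dots,N$. - Upper quasiseparable generators of $U$ with orders $r^U_k$: matrices $g_U(i)$ ($1\times r^U_i$), $i=1,\dots,N-1$, $h_U(j)$ ($r^U_{j-1}\times1$), $j=2,\dots,N$, $b_U(k)$ ($r^U_{k-1}\times r^U_k$), $k=2,\dots,N-1$, such that $U(i,j)=g_U(i)\,b_U(i+1)\cdots b_U(j-1)\,h_U(j)$ for $1\le i<j\le N$ (empty product is the identity). - The vectors $\mathbf z,\mathbf w,\mathbf p,\mathbf q$ and the coefficients $\alpha,\beta,\gamma$ of $p(z)$. Put $\sigma^V_k=\sigma^A_k+z(k+1)w(k)$ for $k=1,\dots,N-1$ and $d_U(k)=d_B(k)+p(k)q(k)$ for $k=1,\dots,N$. By convention $r^U_N=0$, and $b_U(N)$, $g_U(N)$ are empty (having $0$ columns). **Preparative phase.** 1. Let $\mathbf s=(p(AB^{-1})\mathbf e_1)(1\colon3)$ and choose a $3\times3$ orthogonal matrix $Q_1$ with $Q_1^*\mathbf s=(\times,0,0)^*$. 2. Compute $$\begin{pmatrix}\tilde g_V(3)\\ \beta^V_3\end{pmatrix}=Q_1^*\begin{pmatrix}g_V(1)h_V(1)&g_V(1)b_V(1)h_V(2)&g_V(1)b_V(1)b_V(2)\\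 \sigma^V_1&g_V(2)h_V(2)&g_V(2)b_V(2)\\ z(3)w(1)&\sigma^V_2&g_V(3)\end{pmatrix},$$ where $\tilde g_V(3)$ is the first row, and partition $\beta^V_3=[\,f^V_3\ \ \phi^V_3\,]$ with $f^V_3$ of size $2\times2$ and $\phi^V_3$ of size $2\times r^V_3$. 3. Compute $$\begin{pmatrix}z^{(1)}(1)\\ \chi_3\end{pmatrix}=Q_1^*\begin{pmatrix}z(1)\\ z(2)\\ z(3)\end{pmatrix},\qquad \gamma_2=\begin{pmatrix}w(1)\\ w(2)\end{pmatrix},$$ with $\chi_3\in\mathbb R^2$, and set $f^A_3=f^V_3-\chi_3\gamma_2^*$, $\varphi^A_3=\phi^V_3$. 4. Set $c_2=\begin{pmatrix}p(1)\\ p(2)\end{pmatrix}$, $\theta_2=\begin{pmatrix}q(1)\\ q(2)\end{pmatrix}$, $$f^U_2=\begin{pmatrix}d_U(1)&g_U(1)h_U(2)\\ p(2)q(1)&d_U(2)\end{pmatrix},\quad \phi^U_2=\begin{pmatrix}g_U(1)b_U(2)\\ g_U(2)\end{pmatrix},$$ $\varepsilon=g_U(1)h_U(2)-p(1)q(2)$, $$f^B_2=\begin{pmatrix}d_B(1)&\varepsilon\\ 0&d_B(2)\end{pmatrix},\quad \varphi^B_2=\phi^U_2.$$ **Main loop.** For $k=1,\dots,N-1$ perform the following steps. (a) (Determine $Z_k$.) If $k\le N-2$, compute the two-dimensional column $\varepsilon^B_{k+1}=\varphi^B_{k+1}h_U(k+2)-c_{k+1}q(k+2)$ and the $3\times3$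 matrix $$\Phi_k=Q_k^*\begin{pmatrix}f^B_{k+1}&\varepsilon^B_{k+1}\\ 0&d_B(k+2)\end{pmatrix},$$ and choose a $3\times3$ orthogonal matrix $Z_k$ such that $$\Phi_k(2\colon3,:)\,Z_k=\begin{pmatrix}0&\times&\times\\ 0&0&\times\end{pmatrix}.$$ If $k=N-1$, compute the $2\times2$ matrix $\Phi_{N-1}=Q_{N-1}^*f^B_N$, choose a $2\times2$ Givens rotation $Z_{N-1}$ such that $\Phi_{N-1}(2,:)Z_{N-1}=(0\ \ \times)$, and stop (no further $Q$ or $Z$ matrix is determined). (b) (Determine $Q_{k+1}$, for $k\le N-2$.) Compute $\epsilon^A_{k+2}=\varphi^A_{k+2}h_V(k+2)-\chi_{k+2}w(k+2)$. If $k\le N-3$, compute the $3\times3$ matrix $$\Omega_k=\begin{pmatrix}f^A_{k+2}&\epsilon^A_{k+2}\\ 0&\sigma^A_{k+2}\end{pmatrix}Z_k$$ and choose a $3\times3$ orthogonal matrix $Q_{k+1}$ such that $Q_{k+1}^*\Omega_k(:,1)=(\times,0,0)^*$. If $k=N-2$, compute the $2\times3$ matrix $\Omega_{N-2}=[\,f^A_N\ \ \epsilon^A_N\,]Z_{N-2}$ and choose a $2\times2$ Givens rotation $Q_{N-1}$ such that $Q_{N-1}^*\Omega_{N-2}(:,1)=(\times,0)^*$. (c) (Update for $U$ and $B$, for $k\le N-2$.) Compute $$\begin{pmatrix}\tilde d_U(k+2)&\tilde g_U(k+2)\\ \times&\beta^U_{k+2}\end{pmatrix}=Q_k^*\begin{pmatrix}f^U_{k+1}&\phi^U_{k+1}h_U(k+2)&\phi^U_{k+1}b_U(k+2)\\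 p(k+2)\theta^*_{k+1}&d_U(k+2)&g_U(k+2)\end{pmatrix}\begin{pmatrix}Z_k&0\\ 0&I_{r^U_{k+2}}\end{pmatrix},$$ where $\tilde d_U(k+2)$ is $1\times 1$ and $\beta^U_{k+2}$ has two rows, and partition $\beta^U_{k+2}=[\,f^U_{k+2}\ \ \phi^U_{k+2}\,]$ with blocks of sizes $2\times2$ and $2\times r^U_{k+2}$. Compute $$\begin{pmatrix}p^{(1)}(k)\\ c_{k+2}\end{pmatrix}=Q_k^*\begin{pmatrix}c_{k+1}\\ p(k+2)\end{pmatrix},\qquad \begin{pmatrix}q^{(1)}(k)\\ \theta_{k+2}\end{pmatrix}=Z_k^*\begin{pmatrix}\theta_{k+1}\\ q(k+2)\end{pmatrix}$$ with $c_{k+2},\theta_{k+2}\in\mathbb R^2$, and set $f^B_{k+2}=f^U_{k+2}-c_{k+2}\theta_{k+2}^*$, $\varphi^B_{k+2}=\phi^U_{k+2}$. (d) (Update for $V$ and $A$, for $k\le N-3$.) Compute $$\begin{pmatrix}\tilde d_V(k+3)&\tilde g_V(k+3)\\ \times&\beta^V_{k+3}\end{pmatrix}=Q_{k+1}^*\begin{pmatrix}f^V_{k+2}&\phi^V_{k+2}h_V(k+2)&\phi^V_{k+2}b_V(k+2)\\ z(k+3)\gamma^*_{k+1}&\sigma^V_{k+2}&g_V(k+3)\end{pmatrix}\begin{pmatrix}Z_k&0\\ 0&I_{r^V_{k+3}}\end{pmatrix},$$ where $\tilde d_V(k+3)$ is $1\times1$ and $\beta^V_{k+3}$ has two rows,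 and partition $\beta^V_{k+3}=[\,f^V_{k+3}\ \ \phi^V_{k+3}\,]$ with blocks of sizes $2\times2$ and $2\times r^V_{k+3}$. Compute $$\begin{pmatrix}z^{(1)}(k+1)\\ \chi_{k+3}\end{pmatrix}=Q_{k+1}^*\begin{pmatrix}\chi_{k+2}\\ z(k+3)\end{pmatrix},\qquad \begin{pmatrix}w^{(1)}(k)\\ \gamma_{k+2}\end{pmatrix}=Z_k^*\begin{pmatrix}\gamma_{k+1}\\ w(k+2)\end{pmatrix}$$ with $\chi_{k+3},\gamma_{k+2}\in\mathbb R^2$, and set $f^A_{k+3}=f^V_{k+3}-\chi_{k+3}\gamma_{k+2}^*$, $\varphi^A_{k+3}=\phi^V_{k+3}$. *)

theory Defs
  imports Complex_Main "Jordan_Normal_Form.Matrix" "Jordan_Normal_Form.Gauss_Jordan_Elimination"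
begin

section \<open>Matrices\<close>

text \<open>
  Entries of vectors and matrices are accessed with 0-based indices in the library.
  The angle bracket notation below is 1-based. All sequences of matrices
  (generators, the rotations \<open>Q\<^sub>k\<close> and \<open>Z\<^sub>k\<close>, auxiliary quantities) are functions on
  \<open>nat\<close> with 1-based indices.
\<close>

abbreviation vec_entry :: "'a vec \<Rightarrow> nat \<Rightarrow> 'a" (\<open>_\<langle>_\<rangle>\<close> [1000, 0] 999) where
  "v\<langle>i\<rangle> \<equiv> v $ (i - 1)"

abbreviation mat_entry :: "'a mat \<Rightarrow> nat \<Rightarrow> nat \<Rightarrow> 'a" (\<open>_\<langle>_,_\<rangle>\<close> [1000, 0, 0] 999) where
  "M\<langle>i,j\<rangle> \<equiv> M $$ (i - 1, j - 1)"

abbreviation scalar_mat :: "real \<Rightarrow> real mat" where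
  "scalar_mat x \<equiv> mat_of_rows_list 1 [[x]]"

definition append_cols :: "real mat \<Rightarrow> real mat \<Rightarrow> real mat" (infixr \<open>@\<^sub>c\<close> 66) where
  "M @\<^sub>c M' = four_block_mat M M' (0\<^sub>m 0 (dim_col M)) (0\<^sub>m 0 (dim_col M'))"

definition outer_prod :: "real vec \<Rightarrow> real vec \<Rightarrow> real mat" where
  "outer_prod x y = mat (dim_vec x) (dim_vec y) (\<lambda>(i, j). x $ i * y $ j)"

text \<open>\<open>ordered_prod n F i j\<close> is \<open>F i * F (i+1) * \<dots> * F (j-1)\<close>, and \<open>1\<^sub>m n\<close> if \<open>j \<le> i\<close>.\<close>

definition ordered_prod :: "nat \<Rightarrow> (nat \<Rightarrow> real mat) \<Rightarrow> nat \<Rightarrow> nat \<Rightarrow> real mat" where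
  "ordered_prod n F i j = foldl (*) (1\<^sub>m n) (map F [i..<j])"

text \<open>The library's \<^const>\<open>orthogonal_mat\<close> does not require the columns to have norm one.\<close>

definition orth_matrix :: "nat \<Rightarrow> real mat \<Rightarrow> bool" where
  "orth_matrix n M \<longleftrightarrow> M \<in> carrier_mat n n \<and> M\<^sup>T * M = 1\<^sub>m n \<and> M * M\<^sup>T = 1\<^sub>m n"

definition givens_rotation :: "real mat \<Rightarrow> bool" where
  "givens_rotation M \<longleftrightarrow> (\<exists>c s. c\<^sup>2 + s\<^sup>2 = 1 \<and> M = mat_of_rows_list 2 [[c, s], [- s, c]])"

definition upper_hessenberg :: "real mat \<Rightarrow> bool" where
  "upper_hessenberg M \<longleftrightarrow> (\<forall>i < dim_row M. \<forall>j. j + 1 < i \<longrightarrow> M $$ (i, j) = 0)"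

definition quadratic_at :: "real \<Rightarrow> real \<Rightarrow> real \<Rightarrow> real mat \<Rightarrow> real mat" where
  "quadratic_at \<alpha> \<beta> \<gamma> M = \<alpha> \<cdot>\<^sub>m 1\<^sub>m (dim_row M) + \<beta> \<cdot>\<^sub>m M + \<gamma> \<cdot>\<^sub>m (M ^\<^sub>m 2)"

section \<open>Matrix classes\<close>

definition class_H :: "nat \<Rightarrow> real mat set" where
  "class_H N = {A \<in> carrier_mat N N. upper_hessenberg A \<and>
     (\<exists>V z w. orth_matrix N V \<and> z \<in> carrier_vec N \<and> w \<in> carrier_vec N \<and> A = V - outer_prod z w)}"

definition class_V :: "nat \<Rightarrow> real mat set" where
  "class_V N = {V. orth_matrix N V \<and>
     (\<exists>z \<in> carrier_vec N. \<exists>w \<in> carrier_vec N. upper_hessenberg (V - outer_prod z w))}"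

definition class_T :: "nat \<Rightarrow> real mat set" where
  "class_T N = {B \<in> carrier_mat N N. upper_triangular B \<and>
     (\<exists>U p q. orth_matrix N U \<and> p \<in> carrier_vec N \<and> q \<in> carrier_vec N \<and> B = U - outer_prod p q)}"

definition class_U :: "nat \<Rightarrow> real mat set" where
  "class_U N = {U. orth_matrix N U \<and>
     (\<exists>p \<in> carrier_vec N. \<exists>q \<in> carrier_vec N. upper_triangular (U - outer_prod p q))}"

definition class_P :: "nat \<Rightarrow> (real mat \<times> real mat) set" where
  "class_P N = class_H N \<times> class_T N"

section \<open>Generators\<close>

record generators =
  gen_r :: "nat \<Rightarrow> nat"
  gen_g :: "nat \<Rightarrow> real mat"
  gen_h :: "nat \<Rightarrow> real mat"
  gen_b :: "nat \<Rightarrow> real mat"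

definition upper_triangular_generators :: "nat \<Rightarrow> real mat \<Rightarrow> generators \<Rightarrow> bool" where
  "upper_triangular_generators N V G \<longleftrightarrow>
     (\<forall>i \<in> {1..N}. gen_g G i \<in> carrier_mat 1 (gen_r G i)) \<and>
     (\<forall>i \<in> {1..N}. gen_h G i \<in> carrier_mat (gen_r G i) 1) \<and>
     (\<forall>k \<in> {1..N - 1}. gen_b G k \<in> carrier_mat (gen_r G k) (gen_r G (k + 1))) \<and>
     (\<forall>i j. 1 \<le> i \<and> i \<le> j \<and> j \<le> N \<longrightarrow>
        scalar_mat (V\<langle>i,j\<rangle>) = gen_g G i * ordered_prod (gen_r G i) (gen_b G) i j * gen_h G j)"

text \<open>
  The generators \<open>g(N)\<close> and \<open>b(N)\<close> are not needed to represent the matrix; by convention the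
  order \<open>r\<^sub>N\<close> is \<open>0\<close> and they have no columns.
\<close>

definition upper_quasiseparable_generators :: "nat \<Rightarrow> real mat \<Rightarrow> generators \<Rightarrow> bool" where
  "upper_quasiseparable_generators N U G \<longleftrightarrow>
     gen_r G N = 0 \<and>
     (\<forall>i \<in> {1..N}. gen_g G i \<in> carrier_mat 1 (gen_r G i)) \<and>
     (\<forall>j \<in> {2..N}. gen_h G j \<in> carrier_mat (gen_r G (j - 1)) 1) \<and>
     (\<forall>k \<in> {2..N}. gen_b G k \<in> carrier_mat (gen_r G (k - 1)) (gen_r G k)) \<and>
     (\<forall>i j. 1 \<le> i \<and> i < j \<and> j \<le> N \<longrightarrow>
        scalar_mat (U\<langle>i,j\<rangle>) = gen_g G i * ordered_prod (gen_r G i) (gen_b G) (i + 1) j * gen_h G j)"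

section \<open>The double-shift procedure\<close>

record input_data =
  sigma_A :: "nat \<Rightarrow> real"
  d_B :: "nat \<Rightarrow> real"
  gens_V :: generators
  gens_U :: generators
  vec_z :: "real vec"
  vec_w :: "real vec"
  vec_p :: "real vec"
  vec_q :: "real vec"

abbreviation "r_V D \<equiv> gen_r (gens_V D)"
abbreviation "g_V D \<equiv> gen_g (gens_V D)"
abbreviation "h_V D \<equiv> gen_h (gens_V D)"
abbreviation "b_V D \<equiv> gen_b (gens_V D)"
abbreviation "r_U D \<equiv> gen_r (gens_U D)"
abbreviation "g_U D \<equiv> gen_g (gens_U D)"
abbreviation "h_U D \<equiv> gen_h (gens_U D)"
abbreviation "b_U D \<equiv> gen_b (gens_U D)"

definition sigma_V :: "input_data \<Rightarrow> nat \<Rightarrow> real" where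
  "sigma_V D k = sigma_A D k + (vec_z D)\<langle>k + 1\<rangle> * (vec_w D)\<langle>k\<rangle>"

definition d_U :: "input_data \<Rightarrow> nat \<Rightarrow> real" where
  "d_U D k = d_B D k + (vec_p D)\<langle>k\<rangle> * (vec_q D)\<langle>k\<rangle>"

text \<open>
  The auxiliary quantities of the procedure, each field being a sequence with the subscripts
  used in the algorithm. Quantities computed by the procedure that influence neither these nor
  the rotations (the new generators and the entries of the new perturbation vectors) are not
  recorded.
\<close>

record aux_seqs =
  f_V :: "nat \<Rightarrow> real mat"
  phi_V :: "nat \<Rightarrow> real mat"
  chi :: "nat \<Rightarrow> real vec"
  gam :: "nat \<Rightarrow> real vec"
  f_A :: "nat \<Rightarrow> real mat"
  phi_A :: "nat \<Rightarrow> real mat"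
  f_U :: "nat \<Rightarrow> real mat"
  phi_U :: "nat \<Rightarrow> real mat"
  c_seq :: "nat \<Rightarrow> real vec"
  theta :: "nat \<Rightarrow> real vec"
  f_B :: "nat \<Rightarrow> real mat"
  phi_B :: "nat \<Rightarrow> real mat"

definition first_Q :: "real vec \<Rightarrow> real mat \<Rightarrow> bool" where
  "first_Q s Q1 \<longleftrightarrow> orth_matrix 3 Q1 \<and> (\<exists>x. Q1\<^sup>T *\<^sub>v s = vec_of_list [x, 0, 0])"

definition prepare_V_A :: "input_data \<Rightarrow> real mat \<Rightarrow> aux_seqs \<Rightarrow> bool" where
  "prepare_V_A D Q1 X \<longleftrightarrow>
     (let M = Q1\<^sup>T *
            ((g_V D 1 * h_V D 1 @\<^sub>c g_V D 1 * b_V D 1 * h_V D 2 @\<^sub>c g_V D 1 * b_V D 1 * b_V D 2) @\<^sub>r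
             (scalar_mat (sigma_V D 1) @\<^sub>c g_V D 2 * h_V D 2 @\<^sub>c g_V D 2 * b_V D 2) @\<^sub>r
             (scalar_mat ((vec_z D)\<langle>3\<rangle> * (vec_w D)\<langle>1\<rangle>) @\<^sub>c scalar_mat (sigma_V D 2) @\<^sub>c g_V D 3));
          (_, gV', _, \<beta>V) = split_block M 1 0;
          (f, \<phi>, _, _) = split_block \<beta>V 2 2
      in f_V X 3 = f \<and> phi_V X 3 = \<phi>) \<and>
     chi X 3 = vec_last (Q1\<^sup>T *\<^sub>v vec_of_list [(vec_z D)\<langle>1\<rangle>, (vec_z D)\<langle>2\<rangle>, (vec_z D)\<langle>3\<rangle>]) 2 \<and>
     gam X 2 = vec_of_list [(vec_w D)\<langle>1\<rangle>, (vec_w D)\<langle>2\<rangle>] \<and>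
     f_A X 3 = f_V X 3 - outer_prod (chi X 3) (gam X 2) \<and>
     phi_A X 3 = phi_V X 3"

definition prepare_U_B :: "input_data \<Rightarrow> aux_seqs \<Rightarrow> bool" where
  "prepare_U_B D X \<longleftrightarrow>
     c_seq X 2 = vec_of_list [(vec_p D)\<langle>1\<rangle>, (vec_p D)\<langle>2\<rangle>] \<and>
     theta X 2 = vec_of_list [(vec_q D)\<langle>1\<rangle>, (vec_q D)\<langle>2\<rangle>] \<and>
     f_U X 2 = mat_of_rows_list 2
       [[d_U D 1, (g_U D 1 * h_U D 2)\<langle>1,1\<rangle>],
        [(vec_p D)\<langle>2\<rangle> * (vec_q D)\<langle>1\<rangle>, d_U D 2]] \<and>
     phi_U X 2 = g_U D 1 * b_U D 2 @\<^sub>r g_U D 2 \<and>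
     (let \<epsilon> = (g_U D 1 * h_U D 2)\<langle>1,1\<rangle> - (vec_p D)\<langle>1\<rangle> * (vec_q D)\<langle>2\<rangle>
      in f_B X 2 = mat_of_rows_list 2 [[d_B D 1, \<epsilon>], [0, d_B D 2]]) \<and>
     phi_B X 2 = phi_U X 2"

text \<open>
  In the following, \<open>mat_of_rows 3 [row \<Phi> 1, row \<Phi> 2]\<close> is \<open>\<Phi>(2:3,:)\<close> and \<open>col \<Omega> 0\<close> is \<open>\<Omega>(:,1)\<close>.
\<close>

definition choose_Z :: "input_data \<Rightarrow> aux_seqs \<Rightarrow> nat \<Rightarrow> real mat \<Rightarrow> real mat \<Rightarrow> bool" where
  "choose_Z D X k Qk Zk \<longleftrightarrow>
     (let \<epsilon>B = phi_B X (k + 1) * h_U D (k + 2) -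
                 mat_of_cols 2 [(vec_q D)\<langle>k + 2\<rangle> \<cdot>\<^sub>v c_seq X (k + 1)];
          \<Phi> = Qk\<^sup>T * four_block_mat (f_B X (k + 1)) \<epsilon>B (0\<^sub>m 1 2) (scalar_mat (d_B D (k + 2)))
      in orth_matrix 3 Zk \<and>
         (\<exists>x y t. mat_of_rows 3 [row \<Phi> 1, row \<Phi> 2] * Zk =
                  mat_of_rows_list 3 [[0, x, y], [0, 0, t]]))"

definition choose_last_Z :: "nat \<Rightarrow> aux_seqs \<Rightarrow> real mat \<Rightarrow> real mat \<Rightarrow> bool" where
  "choose_last_Z N X Q_last Z_last \<longleftrightarrow>
     (let \<Phi> = Q_last\<^sup>T * f_B X N
      in givens_rotation Z_last \<and>
         (\<exists>x. mat_of_rows 2 [row \<Phi> 1] * Z_last = mat_of_rows_list 2 [[0, x]]))"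

definition eps_A :: "input_data \<Rightarrow> aux_seqs \<Rightarrow> nat \<Rightarrow> real mat" where
  "eps_A D X j = phi_A X j * h_V D j - mat_of_cols 2 [(vec_w D)\<langle>j\<rangle> \<cdot>\<^sub>v chi X j]"

definition choose_Q :: "input_data \<Rightarrow> aux_seqs \<Rightarrow> nat \<Rightarrow> real mat \<Rightarrow> real mat \<Rightarrow> bool" where
  "choose_Q D X k Zk Q_next \<longleftrightarrow>
     (let \<Omega> = four_block_mat (f_A X (k + 2)) (eps_A D X (k + 2))
                 (0\<^sub>m 1 2) (scalar_mat (sigma_A D (k + 2))) * Zk
      in orth_matrix 3 Q_next \<and> (\<exists>x. Q_next\<^sup>T *\<^sub>v col \<Omega> 0 = vec_of_list [x, 0, 0]))"

definition choose_last_Q :: "nat \<Rightarrow> input_data \<Rightarrow> aux_seqs \<Rightarrow> real mat \<Rightarrow> real mat \<Rightarrow> bool" where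
  "choose_last_Q N D X Zk Q_last \<longleftrightarrow>
     (let \<Omega> = (f_A X N @\<^sub>c eps_A D X N) * Zk
      in givens_rotation Q_last \<and> (\<exists>x. Q_last\<^sup>T *\<^sub>v col \<Omega> 0 = vec_of_list [x, 0]))"

definition update_U_B :: "input_data \<Rightarrow> aux_seqs \<Rightarrow> nat \<Rightarrow> real mat \<Rightarrow> real mat \<Rightarrow> bool" where
  "update_U_B D X k Qk Zk \<longleftrightarrow>
     (let M = Qk\<^sup>T *
            ((f_U X (k + 1) @\<^sub>c phi_U X (k + 1) * h_U D (k + 2) @\<^sub>c phi_U X (k + 1) * b_U D (k + 2)) @\<^sub>r
             (mat_of_row ((vec_p D)\<langle>k + 2\<rangle> \<cdot>\<^sub>v theta X (k + 1)) @\<^sub>c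
                scalar_mat (d_U D (k + 2)) @\<^sub>c g_U D (k + 2))) *
            diag_block_mat [Zk, 1\<^sub>m (r_U D (k + 2))];
          (dU', gU', _, \<beta>U) = split_block M 1 1;
          (f, \<phi>, _, _) = split_block \<beta>U 2 2
      in f_U X (k + 2) = f \<and> phi_U X (k + 2) = \<phi>) \<and>
     c_seq X (k + 2) = vec_last (Qk\<^sup>T *\<^sub>v (c_seq X (k + 1) @\<^sub>v vec_of_list [(vec_p D)\<langle>k + 2\<rangle>])) 2 \<and>
     theta X (k + 2) = vec_last (Zk\<^sup>T *\<^sub>v (theta X (k + 1) @\<^sub>v vec_of_list [(vec_q D)\<langle>k + 2\<rangle>])) 2 \<and>
     f_B X (k + 2) = f_U X (k + 2) - outer_prod (c_seq X (k + 2)) (theta X (k + 2)) \<and>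
     phi_B X (k + 2) = phi_U X (k + 2)"

definition update_V_A :: "input_data \<Rightarrow> aux_seqs \<Rightarrow> nat \<Rightarrow> real mat \<Rightarrow> real mat \<Rightarrow> bool" where
  "update_V_A D X k Q_next Zk \<longleftrightarrow>
     (let M = Q_next\<^sup>T *
            ((f_V X (k + 2) @\<^sub>c phi_V X (k + 2) * h_V D (k + 2) @\<^sub>c phi_V X (k + 2) * b_V D (k + 2)) @\<^sub>r
             (mat_of_row ((vec_z D)\<langle>k + 3\<rangle> \<cdot>\<^sub>v gam X (k + 1)) @\<^sub>c
                scalar_mat (sigma_V D (k + 2)) @\<^sub>c g_V D (k + 3))) *
            diag_block_mat [Zk, 1\<^sub>m (r_V D (k + 3))];
          (dV', gV', _, \<beta>V) = split_block M 1 1;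
          (f, \<phi>, _, _) = split_block \<beta>V 2 2
      in f_V X (k + 3) = f \<and> phi_V X (k + 3) = \<phi>) \<and>
     chi X (k + 3) = vec_last (Q_next\<^sup>T *\<^sub>v (chi X (k + 2) @\<^sub>v vec_of_list [(vec_z D)\<langle>k + 3\<rangle>])) 2 \<and>
     gam X (k + 2) = vec_last (Zk\<^sup>T *\<^sub>v (gam X (k + 1) @\<^sub>v vec_of_list [(vec_w D)\<langle>k + 2\<rangle>])) 2 \<and>
     f_A X (k + 3) = f_V X (k + 3) - outer_prod (chi X (k + 3)) (gam X (k + 2)) \<and>
     phi_A X (k + 3) = phi_V X (k + 3)"

text \<open>
  \<open>Q 1, \<dots>, Q (N-1)\<close> and \<open>Z 1, \<dots>, Z (N-1)\<close> are a possible outcome of the procedure for the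
  starting vector \<open>s\<close>. The rotations are not uniquely determined by the data, hence a relation.
\<close>

definition double_shift_procedure ::
    "nat \<Rightarrow> input_data \<Rightarrow> real vec \<Rightarrow> (nat \<Rightarrow> real mat) \<Rightarrow> (nat \<Rightarrow> real mat) \<Rightarrow> bool" where
  "double_shift_procedure N D s Q Z \<longleftrightarrow> (\<exists>X.
     first_Q s (Q 1) \<and> prepare_V_A D (Q 1) X \<and> prepare_U_B D X \<and>
     (\<forall>k \<in> {1..N - 2}. choose_Z D X k (Q k) (Z k)) \<and>
     choose_last_Z N X (Q (N - 1)) (Z (N - 1)) \<and>
     (\<forall>k \<in> {1..N - 3}. choose_Q D X k (Z k) (Q (k + 1))) \<and>
     choose_last_Q N D X (Z (N - 2)) (Q (N - 1)) \<and>
     (\<forall>k \<in> {1..N - 2}. update_U_B D X k (Q k) (Z k)) \<and>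
     (\<forall>k \<in> {1..N - 3}. update_V_A D X k (Q (k + 1)) (Z k)))"

definition input_of ::
    "real mat \<Rightarrow> real mat \<Rightarrow> generators \<Rightarrow> generators \<Rightarrow>
     real vec \<Rightarrow> real vec \<Rightarrow> real vec \<Rightarrow> real vec \<Rightarrow> input_data" where
  "input_of A B GV GU z w p q =
     \<lparr>sigma_A = (\<lambda>k. A\<langle>k + 1,k\<rangle>), d_B = (\<lambda>k. B\<langle>k,k\<rangle>), gens_V = GV, gens_U = GU,
      vec_z = z, vec_w = w, vec_p = p, vec_q = q\<rparr>"

definition embed_rotation :: "nat \<Rightarrow> (nat \<Rightarrow> real mat) \<Rightarrow> nat \<Rightarrow> real mat" where
  "embed_rotation N F i =
     (if i = N - 1 then diag_block_mat [1\<^sub>m (N - 2), F i]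
      else diag_block_mat [1\<^sub>m (i - 1), F i, 1\<^sub>m (N - i - 2)])"

definition accumulate :: "nat \<Rightarrow> (nat \<Rightarrow> real mat) \<Rightarrow> real mat" where
  "accumulate N F = ordered_prod N (embed_rotation N F) 1 N"

end

theory Submission
  imports Defs
begin

text \<open>
  The procedure is a bulge chase on the pair \<open>(A, B)\<close> in which the matrices are never formed: all
  that is stored is a small window and generators of the part to its right. Two things have to be
  seen: that the chase, performed on the full matrices, has the claimed effect, and that the
  stored quantities are the entries of those matrices on which the chase depends.

  The chase itself. Let \<open>B\<^sub>k\<close> be \<open>B\<close> after the first \<open>k\<close> rotations on either side, and \<open>A\<^sub>k\<close> be \<open>A\<close>
  after \<open>k + 1\<close> rotations on the left and \<open>k\<close> on the right. With \<open>s = 0\<close> for \<open>B\<close> and \<open>s = 1\<close> for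
  \<open>A\<close> both satisfy the same description: below the \<open>s\<close>-th subdiagonal there is at most one nonzero
  entry, the bulge, in column \<open>k\<close> (counting from \<open>0\<close>) directly below that subdiagonal. The next step
  rotates the three rows \<open>k + s, \<dots>, k + s + 2\<close> and the three columns \<open>k, \<dots>, k + 2\<close>, and the rotations
  are chosen such that the first column of the rotated \<open>3 \<times> 3\<close> block vanishes below its top entry.
  Hence the bulge moves one place down the diagonal (\<open>bulge_moves_down\<close>). For \<open>B\<close> the
  right rotation is chosen to this end, for \<open>A\<close> the left one. At the bottom the block has only two
  rows, and the bulge disappears.

  The compact representation. The \<open>3 \<times> 3\<close> block consists of a \<open>2 \<times> 2\<close> window, of the next column of
  the two window rows, and of a row of the original matrix, as the rows below the window are still those
  of the original matrix. The matrices are \<open>V - z w\<^sup>*\<close> and \<open>U - p q\<^sup>*\<close>, and the part of the window rows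
  to the right of the window has not met any right rotation, so it can be kept as a product
  of the original generators with a matrix \<open>\<phi>\<close> having two rows, minus a rank one term. A step multiplies
  \<open>\<phi>\<close> by the next generator, appends the generator of the next row, rotates, and drops the first row.
  The difference between the formulas of the procedure for \<open>V\<close>, \<open>U\<close> and those for \<open>A\<close>, \<open>B\<close> is a rank one term, and it is
  compatible with the rotations because \<open>z\<close>, \<open>w\<close>, \<open>p\<close>, \<open>q\<close> are rotated along. The predicate
  \<open>tracks\<close> expresses this invariant for \<open>A\<close> and \<open>B\<close> simultaneously, and \<open>tracks_step\<close> is
  the induction step.

  The starting vector. As \<open>A B\<^sup>-\<^sup>1\<close> is upper Hessenberg, \<open>p(A B\<^sup>-\<^sup>1) e\<^sub>1\<close> is supported on the first three
  coordinates. The rotation \<open>Q\<^sub>1\<close> turns it into a multiple of \<open>e\<^sub>1\<close>, and all later left rotations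
  fix \<open>e\<^sub>1\<close>.
\<close>

section \<open>Entries of products and of block matrices\<close>

lemma index_mult_sum:
  fixes A B :: "real mat"
  assumes "A \<in> carrier_mat n m" "B \<in> carrier_mat m l" "i < n" "j < l"
  shows "(A * B) $$ (i, j) = (\<Sum>k<m. A $$ (i, k) * B $$ (k, j))"
  using assms by (simp add: scalar_prod_def atLeast0LessThan)

lemma index_mult_vec_sum:
  fixes A :: "real mat"
  assumes "A \<in> carrier_mat n m" "v \<in> carrier_vec m" "i < n"
  shows "(A *\<^sub>v v) $ i = (\<Sum>k<m. A $$ (i, k) * v $ k)"
  using assms by (simp add: scalar_prod_def atLeast0LessThan)

lemma index_two_sided_sum:
  fixes Q W Z :: "real mat"
  assumes "Q \<in> carrier_mat n n" "W \<in> carrier_mat n m" "Z \<in> carrier_mat m m" "i < n" "j < m"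
  shows "(Q\<^sup>T * W * Z) $$ (i, j) = (\<Sum>k<n. \<Sum>l<m. Q $$ (k, i) * W $$ (k, l) * Z $$ (l, j))"
proof -
  have "(Q\<^sup>T * W * Z) $$ (i, j) = (\<Sum>l<m. (Q\<^sup>T * W) $$ (i, l) * Z $$ (l, j))"
    using assms by (intro index_mult_sum) auto
  also have "(Q\<^sup>T * W) $$ (i, l) = (\<Sum>k<n. Q $$ (k, i) * W $$ (k, l))" if "l < m" for l
    using assms that by (subst index_mult_sum[of _ n n _ m]) auto
  then have "(\<Sum>l<m. (Q\<^sup>T * W) $$ (i, l) * Z $$ (l, j)) =
      (\<Sum>l<m. \<Sum>k<n. Q $$ (k, i) * W $$ (k, l) * Z $$ (l, j))"
    by (simp add: sum_distrib_right)
  finally show ?thesis by (simp add: sum.swap[of _ "{..<m}"])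
qed

lemma scalar_mat_carrier [simp]: "scalar_mat x \<in> carrier_mat 1 1"
  by (simp add: mat_of_rows_list_def)

lemma scalar_mat_index [simp]: "scalar_mat x $$ (0, 0) = x"
  by (simp add: mat_of_rows_list_def)

lemma scalar_mat_dim [simp]: "dim_row (scalar_mat x) = 1" "dim_col (scalar_mat x) = 1"
  by (simp_all add: mat_of_rows_list_def)

text \<open>The simplifier writes \<open>1\<close> as \<open>Suc 0\<close>, and the rules above do not match then.\<close>

lemmas scalar_mat_simps [simp] =
  scalar_mat_carrier[unfolded One_nat_def] scalar_mat_index[unfolded One_nat_def]
  scalar_mat_dim[unfolded One_nat_def]

lemma append_cols_carrier [simp]:
  "M \<in> carrier_mat n a \<Longrightarrow> M' \<in> carrier_mat n b \<Longrightarrow> M @\<^sub>c M' \<in> carrier_mat n (a + b)"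
  by (auto simp: append_cols_def)

lemma append_cols_index:
  "M \<in> carrier_mat n a \<Longrightarrow> M' \<in> carrier_mat n b \<Longrightarrow> i < n \<Longrightarrow> j < a + b \<Longrightarrow>
    (M @\<^sub>c M') $$ (i, j) = (if j < a then M $$ (i, j) else M' $$ (i, j - a))"
  by (auto simp: append_cols_def)

lemma append_rows_index:
  "M \<in> carrier_mat a n \<Longrightarrow> M' \<in> carrier_mat b n \<Longrightarrow> i < a + b \<Longrightarrow> j < n \<Longrightarrow>
    (M @\<^sub>r M') $$ (i, j) = (if i < a then M $$ (i, j) else M' $$ (i - a, j))"
  by (auto simp: append_rows_def)

lemma outer_prod_carrier [simp]:
  "x \<in> carrier_vec n \<Longrightarrow> y \<in> carrier_vec m \<Longrightarrow> outer_prod x y \<in> carrier_mat n m"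
  by (auto simp: outer_prod_def)

lemma outer_prod_dim [simp]:
  "dim_row (outer_prod x y) = dim_vec x" "dim_col (outer_prod x y) = dim_vec y"
  by (simp_all add: outer_prod_def)

lemma outer_prod_index [simp]:
  "i < dim_vec x \<Longrightarrow> j < dim_vec y \<Longrightarrow> outer_prod x y $$ (i, j) = x $ i * y $ j"
  by (simp add: outer_prod_def)

lemma orth_matrix_carrier: "orth_matrix n M \<Longrightarrow> M \<in> carrier_mat n n"
  by (simp add: orth_matrix_def)

lemma givens_rotation_carrier: "givens_rotation M \<Longrightarrow> M \<in> carrier_mat 2 2"
  by (auto simp: givens_rotation_def mat_of_rows_list_def)

text \<open>The rotated vectors of the procedure are \<open>vec_last\<close> of a product with three entries.\<close>

lemma vec_last_index:
  fixes Q :: "real mat"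
  assumes "Q \<in> carrier_mat 3 3" "v \<in> carrier_vec 3" "a < 2"
  shows "vec_last (Q\<^sup>T *\<^sub>v v) 2 $ a = (\<Sum>l<3. Q $$ (l, Suc a) * v $ l)"
  using assms by (simp add: vec_last_def index_mult_vec_sum[of _ 3 3] scalar_prod_def atLeast0LessThan)

section \<open>Products of generators\<close>

lemma ordered_prod_empty [simp]: "j \<le> i \<Longrightarrow> ordered_prod n F i j = 1\<^sub>m n"
  by (simp add: ordered_prod_def)

lemma ordered_prod_Suc: "i \<le> j \<Longrightarrow> ordered_prod n F i (Suc j) = ordered_prod n F i j * F j"
  by (simp add: ordered_prod_def)

lemma ordered_prod_carrier:
  assumes "\<And>k. i \<le> k \<Longrightarrow> k < j \<Longrightarrow> F k \<in> carrier_mat (R k) (R (Suc k))" "i \<le> j"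
  shows "ordered_prod (R i) F i j \<in> carrier_mat (R i) (R j)"
  using assms(2,1)
proof (induction j rule: dec_induct)
  case (step j)
  then have "ordered_prod (R i) F i j \<in> carrier_mat (R i) (R j)" "F j \<in> carrier_mat (R j) (R (Suc j))"
    by auto
  then show ?case using step.hyps by (simp add: ordered_prod_Suc)
qed simp

lemma ordered_prod_peel_left:
  assumes "\<And>k. i \<le> k \<Longrightarrow> k < j \<Longrightarrow> F k \<in> carrier_mat (R k) (R (Suc k))" "i < j"
  shows "ordered_prod (R i) F i j = F i * ordered_prod (R (Suc i)) F (Suc i) j"
proof -
  have "Suc i \<le> j" using assms(2) by simp
  then show ?thesis using assms(1)
  proof (induction j rule: dec_induct)
    case base
    then have "F i \<in> carrier_mat (R i) (R (Suc i))" by simp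
    then show ?case by (simp add: ordered_prod_Suc)
  next
    case (step j)
    have car: "F i \<in> carrier_mat (R i) (R (Suc i))" "F j \<in> carrier_mat (R j) (R (Suc j))"
      "ordered_prod (R (Suc i)) F (Suc i) j \<in> carrier_mat (R (Suc i)) (R j)"
      using step by (auto intro!: ordered_prod_carrier)
    then show ?case
      using step by (simp add: ordered_prod_Suc assoc_mult_mat[OF car(1,3,2)])
  qed
qed

section \<open>Matrices acting on a few consecutive coordinates\<close>

text \<open>
  This is \<open>I\<^sub>a \<oplus> R \<oplus> I\<close> of total size \<open>N\<close>. Unlike an iterated block diagonal sum, the entrywise form
  treats the inner and the last rotations uniformly and gives the entries of products with
  it directly.
\<close>

definition place :: "nat \<Rightarrow> nat \<Rightarrow> real mat \<Rightarrow> real mat" where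
  "place N a R = mat N N (\<lambda>(i, j).
     if i \<in> {a..<a + dim_row R} \<and> j \<in> {a..<a + dim_row R} then R $$ (i - a, j - a)
     else if i = j then 1 else 0)"

lemma place_carrier [simp]: "place N a R \<in> carrier_mat N N"
  by (simp add: place_def)

lemma place_dim [simp]: "dim_row (place N a R) = N" "dim_col (place N a R) = N"
  by (simp_all add: place_def)

text \<open>
  A column of \<open>place N a R\<close> is a unit vector or a padded column of \<open>R\<close>. All products with such
  matrices below are evaluated by this sum.
\<close>

lemma place_column_sum:
  fixes x :: "nat \<Rightarrow> real"
  assumes R: "R \<in> carrier_mat n n" and N: "a + n \<le> N" and i: "i < N"
  shows "(\<Sum>l<N. place N a R $$ (l, i) * x l) =
    (if i \<in> {a..<a + n} then \<Sum>l<n. R $$ (l, i - a) * x (a + l) else x i)"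
proof (cases "i \<in> {a..<a + n}")
  case True
  have "(\<Sum>l<N. place N a R $$ (l, i) * x l) = (\<Sum>l\<in>{0 + a..<n + a}. R $$ (l - a, i - a) * x l)"
    using R N i True by (intro sum.mono_neutral_cong_right) (auto simp: place_def)
  also have "\<dots> = (\<Sum>l<n. R $$ (l, i - a) * x (a + l))"
    by (subst sum.shift_bounds_nat_ivl) (simp add: atLeast0LessThan add.commute)
  finally show ?thesis using True by simp
next
  case False
  have "(\<Sum>l<N. place N a R $$ (l, i) * x l) = (\<Sum>l<N. if l = i then x l else 0)"
    using False R i by (intro sum.cong) (auto simp: place_def)
  also have "\<dots> = x i" using i by simp
  finally show ?thesis using False by (simp only: if_False)
qed

lemma place_transpose_mult_index:
  assumes "R \<in> carrier_mat n n" "a + n \<le> N" "X \<in> carrier_mat N m" "i < N" "j < m"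
  shows "((place N a R)\<^sup>T * X) $$ (i, j) =
    (if i \<in> {a..<a + n} then \<Sum>l<n. R $$ (l, i - a) * X $$ (a + l, j) else X $$ (i, j))"
proof -
  have "((place N a R)\<^sup>T * X) $$ (i, j) = (\<Sum>l<N. (place N a R)\<^sup>T $$ (i, l) * X $$ (l, j))"
    using assms by (intro index_mult_sum) auto
  then show ?thesis
    using assms(4) place_column_sum[OF assms(1,2,4), of "\<lambda>l. X $$ (l, j)"] by simp
qed

lemma mult_place_index:
  assumes "R \<in> carrier_mat n n" "a + n \<le> N" "X \<in> carrier_mat m N" "i < m" "j < N"
  shows "(X * place N a R) $$ (i, j) =
    (if j \<in> {a..<a + n} then \<Sum>l<n. X $$ (i, a + l) * R $$ (l, j - a) else X $$ (i, j))"
proof -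
  have "(X * place N a R) $$ (i, j) = (\<Sum>l<N. X $$ (i, l) * place N a R $$ (l, j))"
    using assms by (intro index_mult_sum) auto
  then show ?thesis
    using place_column_sum[OF assms(1,2,5), of "\<lambda>l. X $$ (i, l)"] by (simp add: mult.commute)
qed

lemma place_transpose_mult_vec_index:
  assumes "R \<in> carrier_mat n n" "a + n \<le> N" "v \<in> carrier_vec N" "i < N"
  shows "((place N a R)\<^sup>T *\<^sub>v v) $ i =
    (if i \<in> {a..<a + n} then \<Sum>l<n. R $$ (l, i - a) * v $ (a + l) else v $ i)"
proof -
  have "((place N a R)\<^sup>T *\<^sub>v v) $ i = (\<Sum>l<N. (place N a R)\<^sup>T $$ (i, l) * v $ l)"
    using assms by (intro index_mult_vec_sum) auto
  then show ?thesis
    using assms(4) place_column_sum[OF assms(1,2,4), of "\<lambda>l. v $ l"] by simp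
qed

lemma diag_block_eq_place:
  assumes "R \<in> carrier_mat n n"
  shows "diag_block_mat [1\<^sub>m a, R, 1\<^sub>m b] = place (a + n + b) a R"
proof (rule eq_matI)
  fix i j assume ij: "i < dim_row (place (a + n + b) a R)" "j < dim_col (place (a + n + b) a R)"
  consider "i < a" | "a \<le> i" "i < a + n" | "a + n \<le> i" by linarith
  then show "diag_block_mat [1\<^sub>m a, R, 1\<^sub>m b] $$ (i, j) = place (a + n + b) a R $$ (i, j)"
    using assms ij by cases (auto simp: place_def Let_def)
qed (use assms in \<open>simp_all add: dim_diag_block_mat\<close>)

lemma diag_block_mat_empty_first:
  "diag_block_mat (1\<^sub>m 0 # As) = diag_block_mat As"
  by (auto simp: Let_def)

lemma diag_block_mat_empty_last:
  "diag_block_mat (As @ [1\<^sub>m 0]) = diag_block_mat As"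
  by (induction As) (auto simp: Let_def)

lemma embed_rotation_eq_place:
  assumes "1 \<le> i" "i < N" "F i \<in> carrier_mat n n" "n = (if i = N - 1 then 2 else 3)" "N \<ge> 3"
  shows "embed_rotation N F i = place N (i - 1) (F i)"
proof (cases "i = N - 1")
  case True
  then have "N - 2 + 2 + 0 = N" "i - 1 = N - 2" using assms by auto
  then show ?thesis
    using True assms diag_block_eq_place[of "F i" 2 "N - 2" 0] diag_block_mat_empty_last[of "[1\<^sub>m (N - 2), F i]"]
    by (simp add: embed_rotation_def del: diag_block_mat.simps One_nat_def Suc_1 add_2_eq_Suc')
next
  case False
  then have "i - 1 + 3 + (N - i - 2) = N" using assms by simp
  then show ?thesis
    using False assms diag_block_eq_place[of "F i" 3 "i - 1" "N - i - 2"]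
    by (simp add: embed_rotation_def del: diag_block_mat.simps)
qed

section \<open>A chase step on full matrices\<close>

lemma place_two_sided_carrier [simp]:
  "X \<in> carrier_mat N N \<Longrightarrow> (place N a Q)\<^sup>T * X * place N b Z \<in> carrier_mat N N"
  by (meson mult_carrier_mat place_carrier transpose_carrier_mat)

lemma place_two_sided_index:
  assumes Q: "Q \<in> carrier_mat n n" "a + n \<le> N" and Z: "Z \<in> carrier_mat m m" "b + m \<le> N"
    and S: "S \<in> carrier_mat N N" and i: "i < N" and j: "j < N"
  shows "i \<in> {a..<a + n} \<Longrightarrow> j \<in> {b..<b + m} \<Longrightarrow>
      ((place N a Q)\<^sup>T * S * place N b Z) $$ (i, j) =
      (\<Sum>k<n. \<Sum>l<m. Q $$ (k, i - a) * S $$ (a + k, b + l) * Z $$ (l, j - b))"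
    and "i \<in> {a..<a + n} \<Longrightarrow> j \<notin> {b..<b + m} \<Longrightarrow>
      ((place N a Q)\<^sup>T * S * place N b Z) $$ (i, j) = (\<Sum>k<n. Q $$ (k, i - a) * S $$ (a + k, j))"
    and "i \<notin> {a..<a + n} \<Longrightarrow> j \<in> {b..<b + m} \<Longrightarrow>
      ((place N a Q)\<^sup>T * S * place N b Z) $$ (i, j) = (\<Sum>l<m. S $$ (i, b + l) * Z $$ (l, j - b))"
    and "i \<notin> {a..<a + n} \<Longrightarrow> j \<notin> {b..<b + m} \<Longrightarrow>
      ((place N a Q)\<^sup>T * S * place N b Z) $$ (i, j) = S $$ (i, j)"
proof -
  let ?X = "(place N a Q)\<^sup>T * S"
  have X: "?X \<in> carrier_mat N N" using S by (meson mult_carrier_mat place_carrier transpose_carrier_mat)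
  note col = mult_place_index[OF Z X i j]
  note row = place_transpose_mult_index[OF Q S i]
  show "i \<in> {a..<a + n} \<Longrightarrow> j \<in> {b..<b + m} \<Longrightarrow> (?X * place N b Z) $$ (i, j) =
      (\<Sum>k<n. \<Sum>l<m. Q $$ (k, i - a) * S $$ (a + k, b + l) * Z $$ (l, j - b))"
  proof -
    assume ij: "i \<in> {a..<a + n}" "j \<in> {b..<b + m}"
    have "(?X * place N b Z) $$ (i, j) = (\<Sum>l<m. ?X $$ (i, b + l) * Z $$ (l, j - b))"
      using col ij by (simp only: if_True)
    also have "\<dots> = (\<Sum>l<m. \<Sum>k<n. Q $$ (k, i - a) * S $$ (a + k, b + l) * Z $$ (l, j - b))"
    proof (intro sum.cong refl)
      fix l assume "l \<in> {..<m}"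
      then have "b + l < N" using Z by simp
      then show "?X $$ (i, b + l) * Z $$ (l, j - b) =
          (\<Sum>k<n. Q $$ (k, i - a) * S $$ (a + k, b + l) * Z $$ (l, j - b))"
        using row ij by (simp only: if_True sum_distrib_right)
    qed
    finally show ?thesis by (simp only: sum.swap[of _ "{..<m}"])
  qed
  show "i \<in> {a..<a + n} \<Longrightarrow> j \<notin> {b..<b + m} \<Longrightarrow>
      (?X * place N b Z) $$ (i, j) = (\<Sum>k<n. Q $$ (k, i - a) * S $$ (a + k, j))"
    using col row[OF j] by (simp only: if_True if_False)
  show "i \<notin> {a..<a + n} \<Longrightarrow> j \<in> {b..<b + m} \<Longrightarrow>
      (?X * place N b Z) $$ (i, j) = (\<Sum>l<m. S $$ (i, b + l) * Z $$ (l, j - b))"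
  proof -
    assume ij: "i \<notin> {a..<a + n}" "j \<in> {b..<b + m}"
    have "?X $$ (i, b + l) = S $$ (i, b + l)" if "l < m" for l
      using row[of "b + l"] ij that Z by (simp only: if_False)
    then show ?thesis using col ij by (simp only: if_True) simp
  qed
  show "i \<notin> {a..<a + n} \<Longrightarrow> j \<notin> {b..<b + m} \<Longrightarrow> (?X * place N b Z) $$ (i, j) = S $$ (i, j)"
    using col row[OF j] by (simp only: if_False)
qed

text \<open>
  An entry below the \<open>s\<close>-th subdiagonal that lies outside the rotated rows or columns is a
  combination of entries which vanish already. Of those inside the rotated block, the ones in its
  first column vanish by the choice of the rotations, and the one at \<open>(k + s + 2, k + 1)\<close> is the new
  bulge. The sizes \<open>n\<close> and \<open>m\<close> also cover the end of the chase: there \<open>n = 2\<close>, and the position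
  of the new bulge is outside the matrix.
\<close>

lemma bulge_moves_down:
  fixes S Q Z :: "real mat"
  assumes S: "S \<in> carrier_mat N N"
    and Q: "Q \<in> carrier_mat n n" "k + s + n \<le> N" and Z: "Z \<in> carrier_mat m m" "k + m \<le> N"
    and size: "2 \<le> n" "n \<le> 3" "2 \<le> m" "m \<le> n \<or> k + s + n = N"
    and band: "\<And>i j. i < N \<Longrightarrow> j < N \<Longrightarrow> j + s < i \<Longrightarrow> (i, j) \<noteq> (k + s + 1, k) \<Longrightarrow> S $$ (i, j) = 0"
    and eliminated: "\<And>i. 1 \<le> i \<Longrightarrow> i < n \<Longrightarrow>
      (\<Sum>a<n. \<Sum>l<m. Q $$ (a, i) * S $$ (k + s + a, k + l) * Z $$ (l, 0)) = 0"
    and i: "i < N" and j: "j < N" and ij: "j + s < i" "(i, j) \<noteq> (k + s + 2, k + 1)"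
  shows "((place N (k + s) Q)\<^sup>T * S * place N k Z) $$ (i, j) = 0"
proof -
  note index = place_two_sided_index[OF Q Z S i j]
  show ?thesis
  proof (cases "j \<in> {k..<k + m}"; cases "i \<in> {k + s..<k + s + n}")
    assume win: "j \<in> {k..<k + m}" "i \<in> {k + s..<k + s + n}"
    have "j = k" using win ij size by auto
    then show ?thesis using index(1)[OF win(2,1)] eliminated[of "i - (k + s)"] win ij by simp
  next
    assume win: "j \<in> {k..<k + m}" "i \<notin> {k + s..<k + s + n}"
    have "S $$ (i, k + l) = 0" if "l < m" for l
      using win ij size that i Z by (intro band) auto
    then show ?thesis using index(3)[OF win(2,1)] by simp
  next
    assume win: "j \<notin> {k..<k + m}" "i \<in> {k + s..<k + s + n}"
    have "S $$ (k + s + a, j) = 0" if "a < n" for a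
      using win ij size that i j Q by (intro band) auto
    then show ?thesis using index(2)[OF win(2,1)] by simp
  next
    assume win: "j \<notin> {k..<k + m}" "i \<notin> {k + s..<k + s + n}"
    then show ?thesis using index(4)[OF win(2,1)] band[OF i j] ij size by auto
  qed
qed

section \<open>The compact representation\<close>

text \<open>
  The matrix which the procedure rotates in an update: the window with its next column and the
  generators of the remainder, bordered by one further row.
\<close>

lemma stacked_index:
  fixes F u v r d g :: "real mat"
  assumes car: "F \<in> carrier_mat 2 2" "u \<in> carrier_mat 2 1" "v \<in> carrier_mat 2 n"
    "r \<in> carrier_mat 1 2" "d \<in> carrier_mat 1 1" "g \<in> carrier_mat 1 n"
  defines "Y \<equiv> (F @\<^sub>c u @\<^sub>c v) @\<^sub>r (r @\<^sub>c d @\<^sub>c g)"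
  shows "Y \<in> carrier_mat 3 (3 + n)"
    "\<And>i j. i < 2 \<Longrightarrow> j < 2 \<Longrightarrow> Y $$ (i, j) = F $$ (i, j)"
    "\<And>i. i < 2 \<Longrightarrow> Y $$ (i, 2) = u $$ (i, 0)"
    "\<And>i j. i < 2 \<Longrightarrow> j < n \<Longrightarrow> Y $$ (i, j + 3) = v $$ (i, j)"
    "\<And>j. j < 2 \<Longrightarrow> Y $$ (2, j) = r $$ (0, j)"
    "Y $$ (2, 2) = d $$ (0, 0)"
    "\<And>j. j < n \<Longrightarrow> Y $$ (2, j + 3) = g $$ (0, j)"
proof -
  have uv: "u @\<^sub>c v \<in> carrier_mat 2 (1 + n)" and dg: "d @\<^sub>c g \<in> carrier_mat 1 (1 + n)"
    using append_cols_carrier[OF car(2,3)] append_cols_carrier[OF car(5,6)] by simp_all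
  have top: "F @\<^sub>c u @\<^sub>c v \<in> carrier_mat 2 (2 + (1 + n))"
    and bot: "r @\<^sub>c d @\<^sub>c g \<in> carrier_mat 1 (2 + (1 + n))"
    using append_cols_carrier[OF car(1) uv] append_cols_carrier[OF car(4) dg] by simp_all
  show "Y \<in> carrier_mat 3 (3 + n)"
    using carrier_append_rows[OF top bot] unfolding Y_def by (simp add: numeral_3_eq_3)
  note idx = append_rows_index[OF top bot] append_cols_index[OF car(1) uv] append_cols_index[OF car(2,3)]
    append_cols_index[OF car(4) dg] append_cols_index[OF car(5,6)]
  show "\<And>i j. i < 2 \<Longrightarrow> j < 2 \<Longrightarrow> Y $$ (i, j) = F $$ (i, j)"
    "\<And>i. i < 2 \<Longrightarrow> Y $$ (i, 2) = u $$ (i, 0)"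
    "\<And>i j. i < 2 \<Longrightarrow> j < n \<Longrightarrow> Y $$ (i, j + 3) = v $$ (i, j)"
    "\<And>j. j < 2 \<Longrightarrow> Y $$ (2, j) = r $$ (0, j)"
    "Y $$ (2, 2) = d $$ (0, 0)"
    "\<And>j. j < n \<Longrightarrow> Y $$ (2, j + 3) = g $$ (0, j)"
    unfolding Y_def by (simp_all add: idx)
qed

text \<open>
  The right rotation acts on the window and its next column only, so the generator columns are
  changed by the left rotation alone.
\<close>

lemma rotated_stack_index:
  fixes Q Y Z :: "real mat"
  assumes Q: "Q \<in> carrier_mat 3 3" and Z: "Z \<in> carrier_mat 3 3" and Y: "Y \<in> carrier_mat 3 (3 + n)"
  defines "T \<equiv> Q\<^sup>T * Y * diag_block_mat [Z, 1\<^sub>m n]"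
  shows "T \<in> carrier_mat 3 (3 + n)"
    "\<And>i j. i < 3 \<Longrightarrow> j < 3 \<Longrightarrow> T $$ (i, j) = (\<Sum>a<3. \<Sum>l<3. Q $$ (a, i) * Y $$ (a, l) * Z $$ (l, j))"
    "\<And>i j. i < 3 \<Longrightarrow> j < n \<Longrightarrow> T $$ (i, j + 3) = (\<Sum>a<3. Q $$ (a, i) * Y $$ (a, j + 3))"
proof -
  have X: "Q\<^sup>T * Y \<in> carrier_mat 3 (3 + n)" using Q Y by simp
  have D: "diag_block_mat [Z, 1\<^sub>m n] = place (3 + n) 0 Z"
    using diag_block_eq_place[OF Z, of 0 n] unfolding diag_block_mat_empty_first add_0 .
  show "T \<in> carrier_mat 3 (3 + n)"
    unfolding T_def D using X by (meson mult_carrier_mat place_carrier)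
  have row: "(Q\<^sup>T * Y) $$ (i, j) = (\<Sum>a<3. Q $$ (a, i) * Y $$ (a, j))" if "i < 3" "j < 3 + n" for i j
    using that Q Y by (subst index_mult_sum[of _ 3 3 _ "3 + n"]) auto
  have col: "T $$ (i, j) = (if j < 3 then \<Sum>l<3. (Q\<^sup>T * Y) $$ (i, l) * Z $$ (l, j) else (Q\<^sup>T * Y) $$ (i, j))"
    if "i < 3" "j < 3 + n" for i j
    using mult_place_index[OF Z _ X that] unfolding T_def D by simp
  show "T $$ (i, j) = (\<Sum>a<3. \<Sum>l<3. Q $$ (a, i) * Y $$ (a, l) * Z $$ (l, j))" if "i < 3" "j < 3" for i j
  proof -
    have "T $$ (i, j) = (\<Sum>l<3. \<Sum>a<3. Q $$ (a, i) * Y $$ (a, l) * Z $$ (l, j))"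
      using col[of i j] that by (simp add: row sum_distrib_right)
    also have "\<dots> = (\<Sum>a<3. \<Sum>l<3. Q $$ (a, i) * Y $$ (a, l) * Z $$ (l, j))"
      by (rule sum.swap)
    finally show ?thesis .
  qed
  show "T $$ (i, j + 3) = (\<Sum>a<3. Q $$ (a, i) * Y $$ (a, j + 3))" if "i < 3" "j < n" for i j
    using col[of i "j + 3"] row[of i "j + 3"] that by simp
qed

lemma less_3_cases: "(i::nat) < 3 \<Longrightarrow> i < 2 \<or> i = 2"
  by auto

lemma bordered_index:
  fixes A B :: "real mat"
  assumes "A \<in> carrier_mat 2 2" "i < 3" "j < 3"
  shows "four_block_mat A B (0\<^sub>m 1 2) (scalar_mat d) $$ (i, j) =
    (if i < 2 then if j < 2 then A $$ (i, j) else B $$ (i, j - 2)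
     else if j < 2 then (0\<^sub>m 1 2) $$ (i - 2, j) else d)"
  using assms less_3_cases[OF assms(2)] less_3_cases[OF assms(3)] by (auto simp: index_mat_four_block)

lemma append_vec_3: "v \<in> carrier_vec 2 \<Longrightarrow> v @\<^sub>v vec_of_list [a] \<in> carrier_vec 3"
  by (rule carrier_vecI) simp

text \<open>
  In the preparative phase only a row is split off (\<open>e = 0\<close>), in the updates a row and
  a column (\<open>e = 1\<close>).
\<close>

lemma split_trailing_block:
  fixes T :: "real mat"
  assumes "let M = T; (_, _, _, \<beta>) = split_block M 1 e; (f, \<phi>', _, _) = split_block \<beta> 2 2
      in F = f \<and> \<phi> = \<phi>'"
    and "dim_row T = 3" "dim_col T = e + 2 + r"
  shows "F = mat 2 2 (\<lambda>(i, j). T $$ (i + 1, j + e))"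
    and "\<phi> = mat 2 r (\<lambda>(i, j). T $$ (i + 1, j + e + 2))"
  using assms by (auto simp: split_block_def Let_def intro!: eq_matI)

text \<open>
  The common setting for \<open>B = U - p q\<^sup>*\<close> (with \<open>s = 0\<close>) and \<open>A = V - z w\<^sup>*\<close> (with \<open>s = 1\<close>): \<open>s\<close> is
  the lower bandwidth of \<open>M\<close>, and the subscripts of the generators are shifted such that the
  row \<open>m + s\<close> (counting from \<open>1\<close>) starts with \<open>g m\<close>, and \<open>h j\<close>, \<open>b j\<close> have \<open>R j\<close> rows. Thus \<open>R m\<close> is
  the order \<open>r\<^sup>U\<^bsub>m-1\<^esub>\<close> in the first case, while in the second case \<open>R m\<close> is \<open>r\<^sup>V\<^bsub>m\<^esub>\<close> and \<open>g m\<close> is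
  \<open>g\<^sub>V(m + 1)\<close>.
\<close>

locale rank_one_corrected =
  fixes N s :: nat and M :: "real mat" and R :: "nat \<Rightarrow> nat" and g h b :: "nat \<Rightarrow> real mat"
    and x y :: "real vec"
  assumes size: "3 \<le> N" and bandwidth: "s \<le> 1"
    and M_carrier: "M \<in> carrier_mat N N"
    and x_carrier: "x \<in> carrier_vec N" and y_carrier: "y \<in> carrier_vec N"
    and band: "\<And>i j. i < N \<Longrightarrow> j < N \<Longrightarrow> j + s < i \<Longrightarrow> M $$ (i, j) = 0"
    and h_carrier: "\<And>j. 2 \<le> j \<Longrightarrow> j \<le> N \<Longrightarrow> h j \<in> carrier_mat (R j) 1"
    and b_carrier: "\<And>j. 2 \<le> j \<Longrightarrow> j + s \<le> N \<Longrightarrow> b j \<in> carrier_mat (R j) (R (Suc j))"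
    and g_carrier: "\<And>m. 2 \<le> m \<Longrightarrow> m + s \<le> N \<Longrightarrow> g m \<in> carrier_mat 1 (R (Suc m))"
    and row_above_band: "\<And>m j. 2 \<le> m \<Longrightarrow> m + s \<le> N \<Longrightarrow> m < j \<Longrightarrow> j \<le> N \<Longrightarrow>
      M $$ (m + s - 1, j - 1) =
      (g m * ordered_prod (R (Suc m)) b (Suc m) j * h j) $$ (0, 0) - x $ (m + s - 1) * y $ (j - 1)"
begin

text \<open>
  The invariant of the chase. The matrix \<open>S\<close> is \<open>M\<close> after some steps; its window has the rows
  \<open>k + s\<close>, \<open>k + s + 1\<close> and the columns \<open>k\<close>, \<open>k + 1\<close>. The clauses about entries say: the only
  entry below the band is the bulge; rows below the window are those of \<open>M\<close>; the window
  is \<open>F - c \<theta>\<^sup>*\<close>; to the right of the window its rows are given by \<open>\<phi>\<close>, the original generators,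
  and the original vector \<open>y\<close>.
\<close>

definition tracks ::
    "nat \<Rightarrow> real mat \<Rightarrow> real mat \<Rightarrow> real mat \<Rightarrow> real vec \<Rightarrow> real vec \<Rightarrow> bool" where
  "tracks k S F \<phi> c \<theta> \<longleftrightarrow>
     S \<in> carrier_mat N N \<and> F \<in> carrier_mat 2 2 \<and> \<phi> \<in> carrier_mat 2 (R (k + 3)) \<and>
     c \<in> carrier_vec 2 \<and> \<theta> \<in> carrier_vec 2 \<and>
     (\<forall>i<N. \<forall>j<N. j + s < i \<longrightarrow> (i, j) \<noteq> (k + s + 1, k) \<longrightarrow> S $$ (i, j) = 0) \<and>
     (\<forall>i<N. \<forall>j<N. k + s + 2 \<le> i \<longrightarrow> S $$ (i, j) = M $$ (i, j)) \<and>
     (\<forall>a<2. \<forall>e<2. S $$ (k + s + a, k + e) = F $$ (a, e) - c $ a * \<theta> $ e) \<and>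
     (\<forall>a<2. \<forall>j. k + 3 \<le> j \<longrightarrow> j \<le> N \<longrightarrow> S $$ (k + s + a, j - 1) =
        (\<phi> * ordered_prod (R (k + 3)) b (k + 3) j * h j) $$ (a, 0) - c $ a * y $ (j - 1))"

lemma tracksD:
  assumes "tracks k S F \<phi> c \<theta>"
  shows "S \<in> carrier_mat N N" and "F \<in> carrier_mat 2 2" and "\<phi> \<in> carrier_mat 2 (R (k + 3))"
    and "c \<in> carrier_vec 2" and "\<theta> \<in> carrier_vec 2"
    and "\<And>i j. i < N \<Longrightarrow> j < N \<Longrightarrow> j + s < i \<Longrightarrow> (i, j) \<noteq> (k + s + 1, k) \<Longrightarrow> S $$ (i, j) = 0"
    and "\<And>i j. i < N \<Longrightarrow> j < N \<Longrightarrow> k + s + 2 \<le> i \<Longrightarrow> S $$ (i, j) = M $$ (i, j)"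
    and "\<And>a e. a < 2 \<Longrightarrow> e < 2 \<Longrightarrow> S $$ (k + s + a, k + e) = F $$ (a, e) - c $ a * \<theta> $ e"
    and "\<And>a j. a < 2 \<Longrightarrow> k + 3 \<le> j \<Longrightarrow> j \<le> N \<Longrightarrow> S $$ (k + s + a, j - 1) =
        (\<phi> * ordered_prod (R (k + 3)) b (k + 3) j * h j) $$ (a, 0) - c $ a * y $ (j - 1)"
  using assms unfolding tracks_def by blast+

lemma generator_tail_carrier:
  assumes "2 \<le> m" "m \<le> j" "j \<le> N"
  shows "ordered_prod (R m) b m j \<in> carrier_mat (R m) (R j)"
    and "ordered_prod (R m) b m j * h j \<in> carrier_mat (R m) 1"
proof -
  show "ordered_prod (R m) b m j \<in> carrier_mat (R m) (R j)"
    using assms b_carrier bandwidth by (intro ordered_prod_carrier) auto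
  moreover have "h j \<in> carrier_mat (R j) 1" using assms h_carrier by auto
  ultimately show "ordered_prod (R m) b m j * h j \<in> carrier_mat (R m) 1" by simp
qed

lemma generator_tail_peel:
  assumes "2 \<le> m" "m < j" "j \<le> N"
  shows "ordered_prod (R m) b m j * h j = b m * (ordered_prod (R (Suc m)) b (Suc m) j * h j)"
proof -
  have "ordered_prod (R m) b m j = b m * ordered_prod (R (Suc m)) b (Suc m) j"
    using assms b_carrier bandwidth by (intro ordered_prod_peel_left) auto
  moreover have "b m \<in> carrier_mat (R m) (R (Suc m))" "h j \<in> carrier_mat (R j) 1"
    using assms b_carrier[of m] h_carrier[of j] bandwidth by auto
  ultimately show ?thesis
    using generator_tail_carrier(1)[of "Suc m" j] assms by (simp add: assoc_mult_mat[where n\<^sub>4 = 1])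
qed

text \<open>The matrix from which the procedure computes \<open>\<Phi>\<^sub>k\<close> and \<open>\<Omega>\<^sub>k\<close>.\<close>

definition bulge_block :: "nat \<Rightarrow> real mat \<Rightarrow> real mat \<Rightarrow> real vec \<Rightarrow> real vec \<Rightarrow> real mat" where
  "bulge_block k F \<phi> c \<theta> =
     four_block_mat (F - outer_prod c \<theta>) (\<phi> * h (k + 3) - mat_of_cols 2 [y $ (k + 2) \<cdot>\<^sub>v c])
       (0\<^sub>m 1 2) (scalar_mat (M $$ (k + s + 2, k + 2)))"

lemma next_column:
  assumes inv: "tracks k S F \<phi> c \<theta>" and k: "k + 2 < N" and a: "a < 2"
  shows "S $$ (k + s + a, k + 2) = (\<phi> * h (k + 3)) $$ (a, 0) - c $ a * y $ (k + 2)"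
proof -
  note \<phi> = tracksD(3)[OF inv]
  have "S $$ (k + s + a, k + 3 - 1) =
      (\<phi> * ordered_prod (R (k + 3)) b (k + 3) (k + 3) * h (k + 3)) $$ (a, 0) - c $ a * y $ (k + 3 - 1)"
    using k by (intro tracksD(9)[OF inv a]) simp_all
  moreover have "\<phi> * ordered_prod (R (k + 3)) b (k + 3) (k + 3) = \<phi>"
    using \<phi> by simp
  moreover have "k + 3 - 1 = k + 2" by simp
  ultimately show ?thesis by (simp only:)
qed

lemma next_column_index:
  assumes inv: "tracks k S F \<phi> c \<theta>" and k: "k + 2 < N" and a: "a < 2"
  shows "(\<phi> * h (k + 3) - mat_of_cols 2 [y $ (k + 2) \<cdot>\<^sub>v c]) $$ (a, 0) = S $$ (k + s + a, k + 2)"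
proof -
  have "mat_of_cols 2 [y $ (k + 2) \<cdot>\<^sub>v c] $$ (a, 0) = c $ a * y $ (k + 2)"
    using a tracksD(4)[OF inv] by (simp add: mat_of_cols_index)
  moreover have "(\<phi> * h (k + 3) - mat_of_cols 2 [y $ (k + 2) \<cdot>\<^sub>v c]) $$ (a, 0) =
      (\<phi> * h (k + 3)) $$ (a, 0) - mat_of_cols 2 [y $ (k + 2) \<cdot>\<^sub>v c] $$ (a, 0)"
    using a by (intro index_minus_mat) simp_all
  ultimately show ?thesis using next_column[OF assms] by simp
qed

text \<open>
  The zeros in the last row come from the band of \<open>M\<close>: the row below the window is an original one.
\<close>

lemma bulge_block_index:
  assumes inv: "tracks k S F \<phi> c \<theta>" and k: "k + s + 2 < N" and i: "i < 3" and j: "j < 3"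
  shows "bulge_block k F \<phi> c \<theta> $$ (i, j) = S $$ (k + s + i, k + j)"
proof -
  note car = tracksD(2-5)[OF inv] and window = tracksD(8)[OF inv] and low = tracksD(7)[OF inv]
  have A: "F - outer_prod c \<theta> \<in> carrier_mat 2 2" using car by (simp add: minus_carrier_mat)
  have idx: "bulge_block k F \<phi> c \<theta> $$ (i, j) =
      (if i < 2 then if j < 2 then (F - outer_prod c \<theta>) $$ (i, j)
         else (\<phi> * h (k + 3) - mat_of_cols 2 [y $ (k + 2) \<cdot>\<^sub>v c]) $$ (i, j - 2)
       else if j < 2 then (0\<^sub>m 1 2) $$ (i - 2, j) else M $$ (k + s + 2, k + 2))"
    unfolding bulge_block_def by (rule bordered_index[OF A i j])
  consider "i < 2" "j < 2" | "i < 2" "j = 2" | "i = 2" "j < 2" | "i = 2" "j = 2"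
    using less_3_cases[OF i] less_3_cases[OF j] by auto
  then show ?thesis
  proof cases
    case 1
    then show ?thesis using car using idx by (simp add: window)
  next
    case 2
    show ?thesis
      using 2 k next_column_index[OF inv _ 2(1)] idx by simp
  next
    case 3
    have "S $$ (k + s + 2, k + j) = 0"
      using low[of "k + s + 2" "k + j"] band[of "k + s + 2" "k + j"] 3 k bandwidth by simp
    then show ?thesis using 3 idx by simp
  next
    case 4
    then show ?thesis using idx low[of "k + s + 2" "k + 2"] k by simp
  qed
qed

lemma bulge_block_carrier:
  assumes "tracks k S F \<phi> c \<theta>"
  shows "bulge_block k F \<phi> c \<theta> \<in> carrier_mat 3 3"
proof -
  have "F - outer_prod c \<theta> \<in> carrier_mat 2 2" using tracksD[OF assms] by (simp add: minus_carrier_mat)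
  from four_block_carrier_mat[OF this scalar_mat_carrier] show ?thesis
    unfolding bulge_block_def by (simp add: numeral_3_eq_3 numeral_2_eq_2)
qed

text \<open>
  One update of the procedure is one step of the chase. The stack \<open>Y\<close> rotated in the update differs
  from the block of \<open>S\<close> by the outer product of the extended vectors \<open>(c, x)\<close> and \<open>(\<theta>, y)\<close>. Rotating
  these vectors on the respective sides rotates the outer product, so the difference of the results is
  \<open>c' \<theta>'\<^sup>*\<close> again. To the right of the window, the first generator \<open>b (k + 3)\<close> of the
  remaining product has been absorbed into the stack.
\<close>

lemma tracks_step:
  assumes inv: "tracks k S F \<phi> c \<theta>" and k: "k + s + 2 < N"
    and Q: "Q \<in> carrier_mat 3 3" and Z: "Z \<in> carrier_mat 3 3"
    and eliminated: "\<And>i. 1 \<le> i \<Longrightarrow> i < 3 \<Longrightarrow> (Q\<^sup>T * bulge_block k F \<phi> c \<theta> * Z) $$ (i, 0) = 0"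
    and update: "let T = Q\<^sup>T *
      ((F @\<^sub>c \<phi> * h (k + 3) @\<^sub>c \<phi> * b (k + 3)) @\<^sub>r
       (mat_of_row (x $ (k + s + 2) \<cdot>\<^sub>v \<theta>) @\<^sub>c
          scalar_mat (M $$ (k + s + 2, k + 2) + x $ (k + s + 2) * y $ (k + 2)) @\<^sub>c g (k + 3))) *
      diag_block_mat [Z, 1\<^sub>m (R (k + 4))];
      (d', g', _, \<beta>) = split_block T 1 1;
      (f, \<phi>'', _, _) = split_block \<beta> 2 2
      in F' = f \<and> \<phi>' = \<phi>''"
    and c': "c' = vec_last (Q\<^sup>T *\<^sub>v (c @\<^sub>v vec_of_list [x $ (k + s + 2)])) 2"
    and \<theta>': "\<theta>' = vec_last (Z\<^sup>T *\<^sub>v (\<theta> @\<^sub>v vec_of_list [y $ (k + 2)])) 2"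
  shows "tracks (Suc k) ((place N (k + s) Q)\<^sup>T * S * place N k Z) F' \<phi>' c' \<theta>'"
proof -
  define S' where "S' = (place N (k + s) Q)\<^sup>T * S * place N k Z"
  define Y where "Y = (F @\<^sub>c \<phi> * h (k + 3) @\<^sub>c \<phi> * b (k + 3)) @\<^sub>r
       (mat_of_row (x $ (k + s + 2) \<cdot>\<^sub>v \<theta>) @\<^sub>c
          scalar_mat (M $$ (k + s + 2, k + 2) + x $ (k + s + 2) * y $ (k + 2)) @\<^sub>c g (k + 3))"
  define cx where "cx = c @\<^sub>v vec_of_list [x $ (k + s + 2)]"
  define ty where "ty = \<theta> @\<^sub>v vec_of_list [y $ (k + 2)]"
  note S = tracksD(1)[OF inv] and car = tracksD(2-5)[OF inv]
    and zero = tracksD(6)[OF inv] and low = tracksD(7)[OF inv]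
    and window = tracksD(8)[OF inv] and tail = tracksD(9)[OF inv]
  have gens: "h (k + 3) \<in> carrier_mat (R (k + 3)) 1" "b (k + 3) \<in> carrier_mat (R (k + 3)) (R (k + 4))"
    "g (k + 3) \<in> carrier_mat 1 (R (k + 4))"
    using h_carrier[of "k + 3"] b_carrier[of "k + 3"] g_carrier[of "k + 3"] k by (simp_all add: eval_nat_numeral)
  have stack_car: "\<phi> * h (k + 3) \<in> carrier_mat 2 1" "\<phi> * b (k + 3) \<in> carrier_mat 2 (R (k + 4))"
    "mat_of_row (x $ (k + s + 2) \<cdot>\<^sub>v \<theta>) \<in> carrier_mat 1 2"
    using car gens by (simp_all add: mat_of_row_carrier)
  note stack = stacked_index[OF car(1) stack_car(1,2,3)
      scalar_mat_carrier[of "M $$ (k + s + 2, k + 2) + x $ (k + s + 2) * y $ (k + 2)"] gens(3), folded Y_def]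
  define T where "T = Q\<^sup>T * Y * diag_block_mat [Z, 1\<^sub>m (R (k + 4))]"
  note T_index = rotated_stack_index[OF Q Z stack(1), folded T_def]
  have F': "F' = mat 2 2 (\<lambda>(i, j). T $$ (i + 1, j + 1))"
    and \<phi>': "\<phi>' = mat 2 (R (k + 4)) (\<lambda>(i, j). T $$ (i + 1, j + 3))"
    using split_trailing_block[OF update[folded Y_def, folded T_def] T_index(1)[THEN carrier_matD(1)], of "R (k + 4)"]
      T_index(1) by (simp_all add: eval_nat_numeral)
  have extended: "cx \<in> carrier_vec 3" "ty \<in> carrier_vec 3"
    unfolding cx_def ty_def by (rule append_vec_3[OF car(3)], rule append_vec_3[OF car(4)])
  have cx: "\<And>a. a < 2 \<Longrightarrow> cx $ a = c $ a" "cx $ 2 = x $ (k + s + 2)"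
    and ty: "\<And>a. a < 2 \<Longrightarrow> ty $ a = \<theta> $ a" "ty $ 2 = y $ (k + 2)"
    using car by (auto simp: cx_def ty_def)
  have c'_index: "c' $ a = (\<Sum>l<3. Q $$ (l, Suc a) * cx $ l)" if "a < 2" for a
    using vec_last_index[OF Q extended(1) that] unfolding c' cx_def .
  have \<theta>'_index: "\<theta>' $ a = (\<Sum>l<3. ty $ l * Z $$ (l, Suc a))" if "a < 2" for a
    using vec_last_index[OF Z extended(2) that] unfolding \<theta>' ty_def by (simp add: mult.commute)
  \<comment> \<open>The stack is the block of \<open>S\<close> that is rotated, plus the rank one correction.\<close>
  have stack_left: "Y $$ (a, l) = S $$ (k + s + a, k + l) + cx $ a * ty $ l" if a: "a < 3" and l: "l < 3" for a l
  proof -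
    consider "a < 2" "l < 2" | "a < 2" "l = 2" | "a = 2" "l < 2" | "a = 2" "l = 2"
      using less_3_cases[OF a] less_3_cases[OF l] by auto
    then show ?thesis
    proof cases
      case 1
      then show ?thesis by (simp add: stack window cx ty)
    next
      case 2
      then show ?thesis using next_column[OF inv _ 2(1)] k by (simp add: stack cx ty)
    next
      case 3
      have "S $$ (k + s + 2, k + l) = 0"
        using low[of "k + s + 2" "k + l"] band[of "k + s + 2" "k + l"] 3 k by simp
      then show ?thesis using 3 car by (simp add: stack cx ty mat_of_row_def)
    next
      case 4
      then show ?thesis using low[of "k + s + 2" "k + 2"] k by (simp add: stack cx ty)
    qed
  qed
  note S'_index = place_two_sided_index[OF Q _ Z _ S, of "k + s" k, folded S'_def]
  have kN: "k + s + 3 \<le> N" "k + 3 \<le> N" using k by simp_all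
  have S'_window: "S' $$ (k + s + i, k + j) =
      (\<Sum>a<3. \<Sum>l<3. Q $$ (a, i) * S $$ (k + s + a, k + l) * Z $$ (l, j))" if "i < 3" "j < 3" for i j
    using S'_index(1)[OF kN, of "k + s + i" "k + j"] that kN by simp
  have "S' $$ (i, j) = 0" if "i < N" "j < N" "j + s < i" "(i, j) \<noteq> (k + s + 2, k + 1)" for i j
    unfolding S'_def
  proof (rule bulge_moves_down[OF S Q kN(1) Z kN(2)])
    fix i :: nat assume i: "1 \<le> i" "i < 3"
    have "(Q\<^sup>T * bulge_block k F \<phi> c \<theta> * Z) $$ (i, 0) =
        (\<Sum>a<3. \<Sum>l<3. Q $$ (a, i) * bulge_block k F \<phi> c \<theta> $$ (a, l) * Z $$ (l, 0))"
      using i by (intro index_two_sided_sum Q Z bulge_block_carrier[OF inv]) auto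
    also have "\<dots> = (\<Sum>a<3. \<Sum>l<3. Q $$ (a, i) * S $$ (k + s + a, k + l) * Z $$ (l, 0))"
      by (intro sum.cong refl) (simp add: bulge_block_index[OF inv k])
    finally show "(\<Sum>a<3. \<Sum>l<3. Q $$ (a, i) * S $$ (k + s + a, k + l) * Z $$ (l, 0)) = 0"
      using eliminated[OF i] by simp
  qed (use that zero in auto)
  moreover have "S' $$ (i, j) = M $$ (i, j)" if "i < N" "j < N" "k + s + 3 \<le> i" for i j
  proof (cases "j \<in> {k..<k + 3}")
    case True
    have "S $$ (i, k + l) = 0" "M $$ (i, k + l) = 0" if "l < 3" for l
      using low[of i "k + l"] band[of i "k + l"] that \<open>k + s + 3 \<le> i\<close> \<open>i < N\<close> k by auto
    moreover have "M $$ (i, j) = 0" using band[OF that(1,2)] that True by simp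
    ultimately show ?thesis
      using S'_index(3)[OF kN that(1,2)] that True by auto
  next
    case False
    then show ?thesis using S'_index(4)[OF kN that(1,2)] that low by auto
  qed
  moreover have "S' $$ (Suc k + s + a, Suc k + e) = F' $$ (a, e) - c' $ a * \<theta>' $ e"
    if a: "a < 2" and e: "e < 2" for a e
  proof -
    have "F' $$ (a, e) = (\<Sum>p<3. \<Sum>l<3. Q $$ (p, Suc a) * Y $$ (p, l) * Z $$ (l, Suc e))"
      using a e T_index(2)[of "Suc a" "Suc e"] by (simp add: F')
    also have "\<dots> = (\<Sum>p<3. \<Sum>l<3. Q $$ (p, Suc a) * S $$ (k + s + p, k + l) * Z $$ (l, Suc e) +
        (Q $$ (p, Suc a) * cx $ p) * (ty $ l * Z $$ (l, Suc e)))"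
      by (intro sum.cong refl) (simp add: stack_left algebra_simps)
    also have "\<dots> = S' $$ (k + s + Suc a, k + Suc e) + c' $ a * \<theta>' $ e"
      using a e by (subst S'_window) (simp_all add: sum.distrib c'_index \<theta>'_index sum_product)
    finally show ?thesis by simp
  qed
  moreover have "S' $$ (Suc k + s + a, j - 1) =
      (\<phi>' * ordered_prod (R (Suc k + 3)) b (Suc k + 3) j * h j) $$ (a, 0) - c' $ a * y $ (j - 1)"
    if a: "a < 2" and j: "Suc k + 3 \<le> j" "j \<le> N" for a j
  proof -
    define X where "X = ordered_prod (R (k + 4)) b (k + 4) j * h j"
    have P: "ordered_prod (R (k + 4)) b (k + 4) j \<in> carrier_mat (R (k + 4)) (R j)"
      "h j \<in> carrier_mat (R j) 1" and X: "X \<in> carrier_mat (R (k + 4)) 1"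
      using generator_tail_carrier[of "k + 4" j] h_carrier[of j] j by (auto simp: X_def)
    have \<phi>'_car: "\<phi>' \<in> carrier_mat 2 (R (k + 4))" by (simp add: \<phi>')
    \<comment> \<open>The rows of the stack generate rows \<open>k + s, \<dots>, k + s + 2\<close> of \<open>S\<close> beyond column \<open>k + 2\<close>: the first two
      by splitting off \<open>b (k + 3)\<close>, the last one because it is a row of \<open>M\<close>.\<close>
    have row_gen: "S $$ (k + s + p, j - 1) + cx $ p * y $ (j - 1) =
        (\<Sum>r<R (k + 4). Y $$ (p, r + 3) * X $$ (r, 0))" if p: "p < 3" for p
    proof (cases "p < 2")
      case True
      have "\<phi> * ordered_prod (R (k + 3)) b (k + 3) j * h j = \<phi> * b (k + 3) * X"
      proof -
        have "\<phi> * ordered_prod (R (k + 3)) b (k + 3) j * h j = \<phi> * (ordered_prod (R (k + 3)) b (k + 3) j * h j)"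
          using assoc_mult_mat[OF car(2) generator_tail_carrier(1)[of "k + 3" j] P(2)] j by simp
        also have "ordered_prod (R (k + 3)) b (k + 3) j * h j = b (k + 3) * X"
          using generator_tail_peel[of "k + 3" j] j by (simp add: X_def eval_nat_numeral)
        also have "\<phi> * (b (k + 3) * X) = \<phi> * b (k + 3) * X"
          using assoc_mult_mat[OF car(2) gens(2) X] by simp
        finally show ?thesis .
      qed
      moreover have "(\<phi> * b (k + 3) * X) $$ (p, 0) = (\<Sum>r<R (k + 4). Y $$ (p, r + 3) * X $$ (r, 0))"
        using True index_mult_sum[OF stack_car(2) X True, of 0] by (simp add: stack)
      ultimately show ?thesis
        using tail[OF True, of j] j True by (simp add: cx)
    next
      case False
      then have p2: "p = 2" using p by simp
      have "S $$ (k + s + 2, j - 1) = M $$ (k + 3 + s - 1, j - 1)"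
        using low[of "k + s + 2" "j - 1"] j k by (simp add: add.commute)
      also have "\<dots> = (g (k + 3) * ordered_prod (R (k + 4)) b (k + 4) j * h j) $$ (0, 0) -
          x $ (k + s + 2) * y $ (j - 1)"
        using row_above_band[of "k + 3" j] j k by (simp add: eval_nat_numeral add.commute)
      also have "g (k + 3) * ordered_prod (R (k + 4)) b (k + 4) j * h j = g (k + 3) * X"
        using assoc_mult_mat[OF gens(3) P] by (simp add: X_def)
      also have "(g (k + 3) * X) $$ (0, 0) = (\<Sum>r<R (k + 4). Y $$ (2, r + 3) * X $$ (r, 0))"
        using index_mult_sum[OF gens(3) X, of 0 0] by (simp add: stack)
      finally show ?thesis using p2 by (simp add: cx)
    qed
    have "S' $$ (k + s + Suc a, j - 1) = (\<Sum>p<3. Q $$ (p, Suc a) * S $$ (k + s + p, j - 1))"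
      using S'_index(2)[OF kN, of "k + s + Suc a" "j - 1"] a j kN by fastforce
    also have "\<dots> = (\<Sum>p<3. Q $$ (p, Suc a) * (\<Sum>r<R (k + 4). Y $$ (p, r + 3) * X $$ (r, 0)) -
        Q $$ (p, Suc a) * cx $ p * y $ (j - 1))"
    proof (intro sum.cong refl)
      fix p :: nat assume "p \<in> {..<3}"
      then show "Q $$ (p, Suc a) * S $$ (k + s + p, j - 1) =
          Q $$ (p, Suc a) * (\<Sum>r<R (k + 4). Y $$ (p, r + 3) * X $$ (r, 0)) - Q $$ (p, Suc a) * cx $ p * y $ (j - 1)"
        by (simp only: row_gen[symmetric] lessThan_iff) (simp add: algebra_simps)
    qed
    also have "\<dots> = (\<Sum>p<3. Q $$ (p, Suc a) * (\<Sum>r<R (k + 4). Y $$ (p, r + 3) * X $$ (r, 0))) -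
        c' $ a * y $ (j - 1)"
      using a by (simp only: sum_subtractf c'_index sum_distrib_right)
    also have "(\<Sum>p<3. Q $$ (p, Suc a) * (\<Sum>r<R (k + 4). Y $$ (p, r + 3) * X $$ (r, 0))) =
        (\<Sum>r<R (k + 4). \<Sum>p<3. Q $$ (p, Suc a) * Y $$ (p, r + 3) * X $$ (r, 0))"
      unfolding sum_distrib_left mult.assoc by (rule sum.swap)
    also have "\<dots> = (\<Sum>r<R (k + 4). \<phi>' $$ (a, r) * X $$ (r, 0))"
      using a by (intro sum.cong refl) (simp add: \<phi>' T_index(3) sum_distrib_right)
    also have "\<dots> = (\<phi>' * X) $$ (a, 0)"
      using index_mult_sum[OF \<phi>'_car X a, of 0] by simp
    also have "\<phi>' * X = \<phi>' * ordered_prod (R (k + 4)) b (k + 4) j * h j"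
      using assoc_mult_mat[OF \<phi>'_car P] by (simp add: X_def)
    finally show ?thesis by (simp add: eval_nat_numeral)
  qed
  moreover have "S' \<in> carrier_mat N N" unfolding S'_def using S by simp
  moreover have "c' \<in> carrier_vec 2" "\<theta>' \<in> carrier_vec 2" "F' \<in> carrier_mat 2 2"
    "\<phi>' \<in> carrier_mat 2 (R (Suc k + 3))"
    by (simp_all add: c' \<theta>' F' \<phi>' vec_last_def eval_nat_numeral)
  ultimately show ?thesis
    unfolding S'_def[symmetric] tracks_def by (simp add: add.commute add.left_commute)
qed

end

section \<open>The starting vector\<close>

text \<open>
  Going through the columns \<open>j\<close> from the left, the entry \<open>(i, j)\<close> of \<open>C B = I\<close> reduces to
  \<open>C\<^bsub>i j\<^esub> B\<^bsub>j j\<^esub>\<close> for \<open>i \<ge> j\<close>. For \<open>i = j\<close> this shows that \<open>B\<^bsub>j j\<^esub>\<close> is not zero.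
\<close>

lemma inverse_upper_triangular:
  fixes B C :: "real mat"
  assumes B: "B \<in> carrier_mat n n" "upper_triangular B" and C: "C \<in> carrier_mat n n"
    and CB: "C * B = 1\<^sub>m n"
  shows "upper_triangular C"
proof -
  have entry: "(\<Sum>l\<le>j. C $$ (i, l) * B $$ (l, j)) = (if i = j then 1 else 0)" if "i < n" "j < n" for i j
  proof -
    have "(\<Sum>l\<le>j. C $$ (i, l) * B $$ (l, j)) = (\<Sum>l<n. C $$ (i, l) * B $$ (l, j))"
      using that B upper_triangularD[OF B(2), of j] by (intro sum.mono_neutral_left) auto
    also have "\<dots> = (C * B) $$ (i, j)" using index_mult_sum[OF C B(1) that] by simp
    finally show ?thesis using that CB by simp
  qed
  have "\<forall>i. j < i \<longrightarrow> i < n \<longrightarrow> C $$ (i, j) = 0" if "j < n" for j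
    using that
  proof (induction j rule: less_induct)
    case (less j)
    have diag: "C $$ (i, j) * B $$ (j, j) = (if i = j then 1 else 0)" if "i < n" "j \<le> i" for i
    proof -
      have "(\<Sum>l\<le>j. C $$ (i, l) * B $$ (l, j)) = (\<Sum>l\<in>{j}. C $$ (i, l) * B $$ (l, j))"
        using less that by (intro sum.mono_neutral_right) auto
      then show ?thesis using entry[of i j] that less.prems by simp
    qed
    show ?case using diag[of j] diag less.prems by (metis less_imp_le less_irrefl mult_eq_0_iff order_refl zero_neq_one)
  qed
  then show ?thesis using C by (intro upper_triangularI) auto
qed

lemma mat_inverse_correct:
  fixes B :: "real mat"
  assumes "B \<in> carrier_mat n n" "invertible_mat B"
  shows "the (mat_inverse B) \<in> carrier_mat n n" "the (mat_inverse B) * B = 1\<^sub>m n"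
proof -
  obtain C where C: "B * C = 1\<^sub>m n" "C * B = 1\<^sub>m (dim_row C)"
    using assms by (auto simp: invertible_mat_def inverts_mat_def)
  have "dim_col C = n" using arg_cong[OF C(1), of dim_col] by simp
  moreover have "dim_row C = n" using arg_cong[OF C(2), of dim_col] assms(1) by simp
  ultimately have "C \<in> carrier_mat n n" by auto
  then have "B \<in> Units (ring_mat TYPE(real) n ())"
    using C assms(1) \<open>dim_row C = n\<close> by (auto simp: Units_def ring_mat_def)
  then obtain C' where C': "mat_inverse B = Some C'"
    using mat_inverse(1)[OF assms(1), of "()"] by blast
  from mat_inverse(2)[OF assms(1) C']
  show "the (mat_inverse B) \<in> carrier_mat n n" "the (mat_inverse B) * B = 1\<^sub>m n"
    by (simp_all add: C')
qed

text \<open>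
  A product of an upper Hessenberg and an upper triangular matrix is upper Hessenberg, and the square
  of an upper Hessenberg matrix has at most two nonzero subdiagonals.
\<close>

lemma quadratic_first_column_support:
  fixes A B :: "real mat" and \<alpha> \<beta> \<gamma> :: real
  assumes A: "A \<in> carrier_mat N N" "upper_hessenberg A"
    and B: "B \<in> carrier_mat N N" "upper_triangular B" "invertible_mat B"
  defines "P \<equiv> quadratic_at \<alpha> \<beta> \<gamma> (A * the (mat_inverse B))"
  shows "P \<in> carrier_mat N N"
    and "\<And>i. 3 \<le> i \<Longrightarrow> i < N \<Longrightarrow> (P *\<^sub>v unit_vec N 0) $ i = 0"
proof -
  define C where "C = the (mat_inverse B)"
  have C: "C \<in> carrier_mat N N" "upper_triangular C"
    using mat_inverse_correct[OF B(1,3)] inverse_upper_triangular[OF B(1,2)] by (auto simp: C_def)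
  define M where "M = A * C"
  have M: "M \<in> carrier_mat N N" using A C by (simp add: M_def)
  have hess: "M $$ (k, j) = 0" if "j + 1 < k" "k < N" for k j
  proof -
    have summand: "A $$ (k, l) * C $$ (l, j) = 0" if "l < N" for l
      using that A C \<open>j + 1 < k\<close> \<open>k < N\<close> upper_triangularD[OF C(2), of j l]
      by (cases "l \<le> j") (auto simp: upper_hessenberg_def)
    have "(\<Sum>l<N. A $$ (k, l) * C $$ (l, j)) = 0"
      by (intro sum.neutral ballI summand) simp
    then show ?thesis using that index_mult_sum[OF A(1) C(1), of k j] by (simp add: M_def)
  qed
  show P: "P \<in> carrier_mat N N"
    using M unfolding P_def quadratic_at_def C_def[symmetric] M_def[symmetric] by auto
  fix i assume i: "3 \<le> i" "i < N"
  have "(M * M) $$ (i, 0) = 0"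
  proof -
    have summand: "M $$ (i, l) * M $$ (l, 0) = 0" if "l < N" for l
      using that i by (cases "l \<le> 1") (auto intro: hess)
    have "(\<Sum>l<N. M $$ (i, l) * M $$ (l, 0)) = 0"
      by (intro sum.neutral ballI summand) simp
    then show ?thesis using i index_mult_sum[OF M M, of i 0] by simp
  qed
  moreover have "M ^\<^sub>m 2 = M * M" using M by (simp add: numeral_2_eq_2)
  ultimately have "P $$ (i, 0) = 0"
    using i M hess[of 0 i] unfolding P_def quadratic_at_def C_def[symmetric] M_def[symmetric] by simp
  then show "(P *\<^sub>v unit_vec N 0) $ i = 0"
    using P i by simp
qed

section \<open>Accumulated rotations\<close>

definition partial_accumulate :: "nat \<Rightarrow> (nat \<Rightarrow> real mat) \<Rightarrow> nat \<Rightarrow> real mat" where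
  "partial_accumulate N F k = ordered_prod N (embed_rotation N F) 1 (Suc k)"

lemma partial_accumulate_0 [simp]: "partial_accumulate N F 0 = 1\<^sub>m N"
  by (simp add: partial_accumulate_def)

lemma partial_accumulate_Suc:
  "partial_accumulate N F (Suc k) = partial_accumulate N F k * embed_rotation N F (Suc k)"
  by (simp add: partial_accumulate_def ordered_prod_Suc)

lemma accumulate_eq_partial: "1 \<le> N \<Longrightarrow> accumulate N F = partial_accumulate N F (N - 1)"
  by (simp add: accumulate_def partial_accumulate_def)

locale rotation_sequence =
  fixes N :: nat and F :: "nat \<Rightarrow> real mat"
  assumes size: "3 \<le> N"
    and carrier_3: "\<And>i. 1 \<le> i \<Longrightarrow> i \<le> N - 2 \<Longrightarrow> F i \<in> carrier_mat 3 3"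
    and carrier_2: "F (N - 1) \<in> carrier_mat 2 2"
begin

lemma embed_eq_place:
  assumes "1 \<le> i" "i < N"
  shows "embed_rotation N F i = place N (i - 1) (F i)"
proof (cases "i = N - 1")
  case True
  then show ?thesis
    using embed_rotation_eq_place[of i N F 2] carrier_2 assms size by simp
next
  case False
  then have "i \<le> N - 2" using assms by simp
  then show ?thesis
    using False embed_rotation_eq_place[of i N F 3] carrier_3[of i] assms size by simp
qed

lemma partial_accumulate_step:
  "Suc k < N \<Longrightarrow> partial_accumulate N F (Suc k) = partial_accumulate N F k * place N k (F (Suc k))"
  by (simp add: partial_accumulate_Suc embed_eq_place)

lemma partial_accumulate_carrier: "k < N \<Longrightarrow> partial_accumulate N F k \<in> carrier_mat N N"
proof (induction k)
  case (Suc k)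
  then show ?case
    using mult_carrier_mat[OF _ place_carrier] by (simp add: partial_accumulate_step)
qed simp

text \<open>
  The first rotation maps the starting vector to a multiple of the first unit vector, and the later ones
  do not act on the first coordinate.
\<close>

lemma accumulate_transpose_mult_supported:
  assumes v: "v \<in> carrier_vec N" and support: "\<And>i. 3 \<le> i \<Longrightarrow> i < N \<Longrightarrow> v $ i = 0"
    and first: "(F 1)\<^sup>T *\<^sub>v vec_first v 3 = vec_of_list [\<tau>, 0, 0]"
  shows "(accumulate N F)\<^sup>T *\<^sub>v v = \<tau> \<cdot>\<^sub>v unit_vec N 0"
proof -
  have step: "(partial_accumulate N F (Suc k))\<^sup>T *\<^sub>v v =
      (place N k (F (Suc k)))\<^sup>T *\<^sub>v ((partial_accumulate N F k)\<^sup>T *\<^sub>v v)" if "Suc k < N" for k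
  proof -
    have X: "partial_accumulate N F k \<in> carrier_mat N N"
      using that by (intro partial_accumulate_carrier) simp
    have "(partial_accumulate N F (Suc k))\<^sup>T =
        (place N k (F (Suc k)))\<^sup>T * (partial_accumulate N F k)\<^sup>T"
      using that by (simp only: partial_accumulate_step transpose_mult[OF X place_carrier])
    then show ?thesis
      using X v by (simp add: assoc_mult_mat_vec[of _ N N _ N])
  qed
  have F1: "F 1 \<in> carrier_mat 3 3" using carrier_3[of 1] size by simp
  have "(partial_accumulate N F (Suc k))\<^sup>T *\<^sub>v v = \<tau> \<cdot>\<^sub>v unit_vec N 0" if "Suc k < N" for k
    using that
  proof (induction k)
    case 0
    have "(\<Sum>l<3. F 1 $$ (l, i) * v $ l) = (if i = 0 then \<tau> else 0)" if i: "i < 3" for i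
    proof -
      have "(\<Sum>l<3. F 1 $$ (l, i) * v $ l) = ((F 1)\<^sup>T *\<^sub>v vec_first v 3) $ i"
        using i F1 v size by (subst index_mult_vec_sum[of _ 3 3]) (auto simp: vec_first_def)
      also have "\<dots> = (if i = 0 then \<tau> else 0)"
        unfolding first using i by (auto simp: less_Suc_eq numeral_3_eq_3)
      finally show ?thesis .
    qed
    then have "(place N 0 (F 1))\<^sup>T *\<^sub>v v = \<tau> \<cdot>\<^sub>v unit_vec N 0"
      using size support
      by (intro eq_vecI) (auto simp: place_transpose_mult_vec_index[OF F1[unfolded One_nat_def] _ v]
          simp del: index_mult_mat_vec)
    then show ?case using step[OF 0] v by simp
  next
    case (Suc k)
    obtain n where n: "F (Suc (Suc k)) \<in> carrier_mat n n" "Suc k + n \<le> N"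
    proof (cases "Suc (Suc k) = N - 1")
      case True
      then show ?thesis using that[of 2] carrier_2 Suc.prems by simp
    next
      case False
      then show ?thesis using that[of 3] carrier_3[of "Suc (Suc k)"] Suc.prems by simp
    qed
    have "(place N (Suc k) (F (Suc (Suc k))))\<^sup>T *\<^sub>v (\<tau> \<cdot>\<^sub>v unit_vec N 0) = \<tau> \<cdot>\<^sub>v unit_vec N 0"
      using n size
      by (intro eq_vecI) (auto simp: place_transpose_mult_vec_index[OF n] simp del: index_mult_mat_vec)
    then show ?case using step[OF Suc.prems] Suc by simp
  qed
  from this[of "N - 2"] show ?thesis
    using size accumulate_eq_partial[of N F] by (simp add: numeral_2_eq_2 Suc_diff_Suc)
qed

end

lemma two_sided_step:
  fixes X Y E E' M :: "real mat"
  assumes "X \<in> carrier_mat N N" "Y \<in> carrier_mat N N" "E \<in> carrier_mat N N" "E' \<in> carrier_mat N N"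
    "M \<in> carrier_mat N N"
  shows "(X * E)\<^sup>T * M * (Y * E') = E\<^sup>T * (X\<^sup>T * M * Y) * E'"
  using assms by (simp add: transpose_mult[of _ N N] assoc_mult_mat[where n\<^sub>2 = N and n\<^sub>3 = N and n\<^sub>4 = N])

section \<open>The choice of the rotations\<close>

text \<open>
  The two ways in which the procedure states that the first column of a rotated block vanishes below
  its top entry: by the rows computed for the choice of \<open>Z\<^sub>k\<close>, and by the column computed for the
  choice of \<open>Q\<^bsub>k+1\<^esub>\<close>.
\<close>

lemma eliminated_rows:
  fixes \<Phi> Z :: "real mat"
  assumes "\<Phi> \<in> carrier_mat 3 3" "Z \<in> carrier_mat 3 3"
    and "mat_of_rows 3 [row \<Phi> 1, row \<Phi> 2] * Z = mat_of_rows_list 3 [[0, u, v], [0, 0, t]]"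
    and "1 \<le> i" "i < 3"
  shows "(\<Phi> * Z) $$ (i, 0) = 0"
proof -
  have "(\<Phi> * Z) $$ (i, 0) = (mat_of_rows 3 [row \<Phi> 1, row \<Phi> 2] * Z) $$ (i - 1, 0)"
    using assms(1,2,4,5) less_3_cases[OF assms(5)]
    by (auto simp: mat_of_rows_def scalar_prod_def less_Suc_eq numeral_2_eq_2)
  also have "\<dots> = 0"
    unfolding assms(3) using assms(4,5) less_3_cases[OF assms(5)]
    by (auto simp: mat_of_rows_list_def less_Suc_eq numeral_2_eq_2)
  finally show ?thesis .
qed

lemma eliminated_column:
  fixes Q W Z :: "real mat"
  assumes "Q \<in> carrier_mat n n" "W \<in> carrier_mat n m" "Z \<in> carrier_mat m m" "i < n" "0 < m"
  shows "(Q\<^sup>T * W * Z) $$ (i, 0) = (Q\<^sup>T *\<^sub>v col (W * Z) 0) $ i"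
proof -
  have "Q\<^sup>T * W * Z = Q\<^sup>T * (W * Z)"
    using assms by (intro assoc_mult_mat) auto
  then show ?thesis using assms by simp
qed

section \<open>The triangular matrix\<close>

lemma input_of_simps [simp]:
  "sigma_A (input_of A B GV GU z w p q) = (\<lambda>k. A $$ (k, k - 1))"
  "d_B (input_of A B GV GU z w p q) = (\<lambda>k. B $$ (k - 1, k - 1))"
  "gens_V (input_of A B GV GU z w p q) = GV"
  "gens_U (input_of A B GV GU z w p q) = GU"
  "vec_z (input_of A B GV GU z w p q) = z"
  "vec_w (input_of A B GV GU z w p q) = w"
  "vec_p (input_of A B GV GU z w p q) = p"
  "vec_q (input_of A B GV GU z w p q) = q"
  by (simp_all add: input_of_def)

text \<open>
  Before the first step, the window of \<open>B\<close> is its leading \<open>2 \<times> 2\<close> block. The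
  last pair of rotations acts on a \<open>2 \<times> 2\<close> block at the bottom and removes the bulge.
\<close>

lemma upper_triangular_result:
  fixes N :: nat and A B U :: "real mat"
  assumes N: "3 \<le> N"
    and B: "B \<in> carrier_mat N N" "upper_triangular B"
    and U: "U \<in> carrier_mat N N" and p: "p \<in> carrier_vec N" and q: "q \<in> carrier_vec N"
    and BU: "B = U - outer_prod p q"
    and gens: "upper_quasiseparable_generators N U GU"
    and D: "D = input_of A B GV GU z w p q"
    and rotQ: "rotation_sequence N Q" and rotZ: "rotation_sequence N Z"
    and prep: "prepare_U_B D X"
    and choose: "\<And>k. 1 \<le> k \<Longrightarrow> k \<le> N - 2 \<Longrightarrow> choose_Z D X k (Q k) (Z k)"
    and last: "choose_last_Z N X (Q (N - 1)) (Z (N - 1))"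
    and update: "\<And>k. 1 \<le> k \<Longrightarrow> k \<le> N - 2 \<Longrightarrow> update_U_B D X k (Q k) (Z k)"
  shows "upper_triangular ((accumulate N Q)\<^sup>T * B * accumulate N Z)"
proof -
  interpret rotQ: rotation_sequence N Q by (rule rotQ)
  interpret rotZ: rotation_sequence N Z by (rule rotZ)
  let ?r = "gen_r GU" and ?g = "gen_g GU" and ?h = "gen_h GU" and ?b = "gen_b GU"
  have g: "\<And>i. 1 \<le> i \<Longrightarrow> i \<le> N \<Longrightarrow> ?g i \<in> carrier_mat 1 (?r i)"
    and h: "\<And>j. 2 \<le> j \<Longrightarrow> j \<le> N \<Longrightarrow> ?h j \<in> carrier_mat (?r (j - 1)) 1"
    and b: "\<And>k. 2 \<le> k \<Longrightarrow> k \<le> N \<Longrightarrow> ?b k \<in> carrier_mat (?r (k - 1)) (?r k)"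
    and "\<And>i j. 1 \<le> i \<Longrightarrow> i < j \<Longrightarrow> j \<le> N \<Longrightarrow>
      scalar_mat (U\<langle>i,j\<rangle>) = ?g i * ordered_prod (?r i) ?b (i + 1) j * ?h j"
    using gens unfolding upper_quasiseparable_generators_def by auto
  then have U_index: "U $$ (i - 1, j - 1) = (?g i * ordered_prod (?r i) ?b (Suc i) j * ?h j) $$ (0, 0)"
    if "1 \<le> i" "i < j" "j \<le> N" for i j
    using that by (metis Suc_eq_plus1 scalar_mat_index)
  have B_index: "B $$ (i, j) = U $$ (i, j) - p $ i * q $ j" if "i < N" "j < N" for i j
    using that U p q by (auto simp: BU)
  interpret W: rank_one_corrected N 0 B "\<lambda>m. ?r (m - 1)" ?g ?h ?b p q
  proof
    show "B $$ (i, j) = 0" if "i < N" "j < N" "j + 0 < i" for i j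
      using B that by auto
    show "B $$ (m + 0 - 1, j - 1) = (?g m * ordered_prod (?r (Suc m - 1)) ?b (Suc m) j * ?h j) $$ (0, 0) -
        p $ (m + 0 - 1) * q $ (j - 1)" if "2 \<le> m" "m + 0 \<le> N" "m < j" "j \<le> N" for m j
      using that B_index[of "m - 1" "j - 1"] U_index[of m j] by simp
  qed (use N B p q g h b in auto)
  have start: "W.tracks 0 B (f_U X 2) (phi_U X 2) (c_seq X 2) (theta X 2)"
  proof -
    have c: "c_seq X 2 = vec_of_list [p $ 0, p $ 1]" and \<theta>: "theta X 2 = vec_of_list [q $ 0, q $ 1]"
      and f: "f_U X 2 = mat_of_rows_list 2
        [[B $$ (0, 0) + p $ 0 * q $ 0, (?g 1 * ?h 2) $$ (0, 0)], [p $ 1 * q $ 0, B $$ (1, 1) + p $ 1 * q $ 1]]"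
      and \<phi>: "phi_U X 2 = ?g 1 * ?b 2 @\<^sub>r ?g 2"
      using prep by (auto simp: prepare_U_B_def D d_U_def)
    have gb: "?g 1 * ?b 2 \<in> carrier_mat 1 (?r 2)" using g[of 1] b[of 2] N by simp
    have g2: "?g 2 \<in> carrier_mat 1 (?r 2)" using g[of 2] N by simp
    have \<phi>_car: "phi_U X 2 \<in> carrier_mat 2 (?r 2)"
      using carrier_append_rows[OF gb g2] unfolding \<phi> one_add_one .
    have c_index: "\<And>a. a < 2 \<Longrightarrow> c_seq X 2 $ a = p $ a" and \<theta>_index: "\<And>a. a < 2 \<Longrightarrow> theta X 2 $ a = q $ a"
      by (auto simp: c \<theta> less_2_cases_iff)
    have f_car: "f_U X 2 \<in> carrier_mat 2 2" 
      unfolding f mat_of_rows_list_def by (rule carrier_matI) simp_all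
    have vec_car: "c_seq X 2 \<in> carrier_vec 2" "theta X 2 \<in> carrier_vec 2"
      unfolding c \<theta> by (rule carrier_vecI, simp)+
    have window: "B $$ (a, e) = f_U X 2 $$ (a, e) - c_seq X 2 $ a * theta X 2 $ e" if "a < 2" "e < 2" for a e
    proof -
      have "?g 1 * ordered_prod (?r 1) ?b (Suc 1) 2 * ?h 2 = ?g 1 * ?h 2"
        using g[of 1] N by (simp add: numeral_2_eq_2)
      then have "U $$ (0, 1) = (?g 1 * ?h 2) $$ (0, 0)"
        using U_index[of 1 2] N by simp
      moreover have "B $$ (1, 0) = 0" using B N by auto
      moreover have "(a, e) \<in> {(0, 0), (0, 1), (1, 0), (1, 1)}" using that by auto
      ultimately show ?thesis
        using N B_index[of 0 1] c_index[of a] \<theta>_index[of e] that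
        by (auto simp: f mat_of_rows_list_def)
    qed
    have tail: "B $$ (a, j - 1) = (phi_U X 2 * ordered_prod (?r 2) ?b 3 j * ?h j) $$ (a, 0) -
        c_seq X 2 $ a * q $ (j - 1)" if a: "a < 2" and j: "3 \<le> j" "j \<le> N" for a j
    proof -
      define Y where "Y = ordered_prod (?r 2) ?b 3 j * ?h j"
      have P: "ordered_prod (?r 2) ?b 3 j \<in> carrier_mat (?r 2) (?r (j - 1))"
        "?h j \<in> carrier_mat (?r (j - 1)) 1" and Y: "Y \<in> carrier_mat (?r 2) 1"
        using W.generator_tail_carrier[of 3 j] h[of j] j by (auto simp: Y_def)
      have "phi_U X 2 * ordered_prod (?r 2) ?b 3 j * ?h j = phi_U X 2 * Y"
        using assoc_mult_mat[OF \<phi>_car P] by (simp add: Y_def)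
      moreover have "(phi_U X 2 * Y) $$ (a, 0) = U $$ (a, j - 1)"
      proof (cases "a = 0")
        case True
        have g1: "?g 1 \<in> carrier_mat 1 (?r 1)" and b2: "?b 2 \<in> carrier_mat (?r 1) (?r 2)"
          using g[of 1] b[of 2] N by simp_all
        have tail1: "ordered_prod (?r 1) ?b 2 j \<in> carrier_mat (?r 1) (?r (j - 1))"
          "ordered_prod (?r 1) ?b 2 j * ?h j = ?b 2 * Y"
          using W.generator_tail_carrier(1)[of 2 j] W.generator_tail_peel[of 2 j] j
          by (simp_all add: Y_def numeral_3_eq_3 numeral_2_eq_2)
        have "?g 1 * ordered_prod (?r 1) ?b 2 j * ?h j = ?g 1 * (?b 2 * Y)"
          using assoc_mult_mat[OF g1 tail1(1) P(2)] tail1(2) by simp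
        also have "\<dots> = ?g 1 * ?b 2 * Y" using assoc_mult_mat[OF g1 b2 Y] by simp
        finally have "U $$ (0, j - 1) = (?g 1 * ?b 2 * Y) $$ (0, 0)"
          using U_index[of 1 j] j by (simp add: numeral_2_eq_2)
        also have "\<dots> = (phi_U X 2 * Y) $$ (0, 0)"
          using index_mult_sum[OF gb Y, of 0 0] index_mult_sum[OF \<phi>_car Y, of 0 0]
            append_rows_index[OF gb g2, of 0] by (simp add: \<phi>)
        finally show ?thesis using True by simp
      next
        case False
        then have a1: "a = 1" using a by simp
        have "?g 2 * ordered_prod (?r 2) ?b 3 j * ?h j = ?g 2 * Y"
          using assoc_mult_mat[OF g2 P] by (simp add: Y_def)
        then have "U $$ (1, j - 1) = (?g 2 * Y) $$ (0, 0)"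
          using U_index[of 2 j] j by (simp add: numeral_3_eq_3 numeral_2_eq_2)
        also have "\<dots> = (phi_U X 2 * Y) $$ (1, 0)"
          using index_mult_sum[OF g2 Y, of 0 0] index_mult_sum[OF \<phi>_car Y, of 1 0]
            append_rows_index[OF gb g2, of 1] by (simp add: \<phi>)
        finally show ?thesis using a1 by simp
      qed
      ultimately show ?thesis using B_index[of a "j - 1"] a j N c_index[OF a] by simp
    qed
    show ?thesis
      unfolding W.tracks_def add_0 add_0_right
    proof (intro conjI allI impI)
      show "B $$ (i, j) = 0" if "i < N" "j < N" "j < i" for i j using B that by auto
      show "phi_U X 2 \<in> carrier_mat 2 (?r (3 - 1))" using \<phi>_car by simp
      show "B $$ (a, j - 1) = (phi_U X 2 * ordered_prod (?r (3 - 1)) ?b 3 j * ?h j) $$ (a, 0) -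
          c_seq X 2 $ a * q $ (j - 1)" if "a < 2" "3 \<le> j" "j \<le> N" for a j
        using tail[OF that] by simp
    qed (rule B f_car vec_car window refl | assumption)+
  qed
  let ?S = "\<lambda>k. (partial_accumulate N Q k)\<^sup>T * B * partial_accumulate N Z k"
  have S_Suc: "?S (Suc k) = (place N (k + 0) (Q (Suc k)))\<^sup>T * ?S k * place N k (Z (Suc k))" if "Suc k < N" for k
    unfolding rotQ.partial_accumulate_step[OF that] rotZ.partial_accumulate_step[OF that] add_0_right
    using that B(1) rotQ.partial_accumulate_carrier[of k] rotZ.partial_accumulate_carrier[of k]
    by (intro two_sided_step[where N = N]) simp_all
  have chase: "W.tracks k (?S k) (f_U X (k + 2)) (phi_U X (k + 2)) (c_seq X (k + 2)) (theta X (k + 2)) \<and>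
      f_B X (k + 2) = f_U X (k + 2) - outer_prod (c_seq X (k + 2)) (theta X (k + 2)) \<and>
      phi_B X (k + 2) = phi_U X (k + 2)"
    if "k \<le> N - 2" for k
    using that
  proof (induction k)
    case 0
    have "f_B X 2 = f_U X 2 - outer_prod (c_seq X 2) (theta X 2)" "phi_B X 2 = phi_U X 2"
      using prep
      by (auto simp: prepare_U_B_def D d_U_def mat_of_rows_list_def less_Suc_eq intro!: eq_matI)
    moreover have "?S 0 = B" using B(1) by simp
    ultimately show ?case using start by (simp only: add_0)
  next
    case (Suc k)
    have k: "Suc k \<le> N - 2" "k + 0 + 2 < N" using Suc.prems N by simp_all
    have eqs: "Suc k + 1 = k + 2" "Suc k + 2 = k + 3" "k + 3 - 1 = k + 2" "k + 0 + 2 = k + 2" "k + 4 - 1 = k + 3"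
      by simp_all
    note D_simps = D input_of_simps d_U_def
    have le: "1 \<le> Suc k" by simp
    note upd = update[OF le k(1), unfolded update_U_B_def D_simps eqs]
    note ch = choose[OF le k(1), unfolded choose_Z_def D_simps eqs Let_def]
    have QZ: "Q (Suc k) \<in> carrier_mat 3 3" "Z (Suc k) \<in> carrier_mat 3 3"
      using rotQ.carrier_3[of "Suc k"] rotZ.carrier_3[of "Suc k"] k by simp_all
    have IH: "W.tracks k (?S k) (f_U X (k + 2)) (phi_U X (k + 2)) (c_seq X (k + 2)) (theta X (k + 2))"
      "f_B X (k + 2) = f_U X (k + 2) - outer_prod (c_seq X (k + 2)) (theta X (k + 2))"
      "phi_B X (k + 2) = phi_U X (k + 2)"
      using Suc by auto
    have block: "W.bulge_block k (f_U X (k + 2)) (phi_U X (k + 2)) (c_seq X (k + 2)) (theta X (k + 2)) \<in> carrier_mat 3 3"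
      by (rule W.bulge_block_carrier[OF IH(1)])
    have "W.tracks (Suc k) ((place N (k + 0) (Q (Suc k)))\<^sup>T * ?S k * place N k (Z (Suc k)))
      (f_U X (k + 3)) (phi_U X (k + 3)) (c_seq X (k + 3)) (theta X (k + 3))"
    proof (rule W.tracks_step[OF IH(1) k(2) QZ])
      fix i :: nat assume i: "1 \<le> i" "i < 3"
      have W: "W.bulge_block k (f_U X (k + 2)) (phi_U X (k + 2)) (c_seq X (k + 2)) (theta X (k + 2)) =
          four_block_mat (f_B X (k + 2))
            (phi_B X (k + 2) * ?h (k + 3) - mat_of_cols 2 [q $ (k + 2) \<cdot>\<^sub>v c_seq X (k + 2)])
            (0\<^sub>m 1 2) (scalar_mat (B $$ (k + 2, k + 2)))"
        unfolding W.bulge_block_def IH(2,3) eqs ..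
      have \<Phi>: "(Q (Suc k))\<^sup>T *
          W.bulge_block k (f_U X (k + 2)) (phi_U X (k + 2)) (c_seq X (k + 2)) (theta X (k + 2)) \<in> carrier_mat 3 3"
        using QZ(1) block by simp
      obtain u v t where "mat_of_rows 3
          [row ((Q (Suc k))\<^sup>T * W.bulge_block k (f_U X (k + 2)) (phi_U X (k + 2)) (c_seq X (k + 2)) (theta X (k + 2))) 1,
           row ((Q (Suc k))\<^sup>T * W.bulge_block k (f_U X (k + 2)) (phi_U X (k + 2)) (c_seq X (k + 2)) (theta X (k + 2))) 2] *
          Z (Suc k) = mat_of_rows_list 3 [[0, u, v], [0, 0, t]]"
        using ch unfolding W by blast
      from eliminated_rows[OF \<Phi> QZ(2) this i]
      show "((Q (Suc k))\<^sup>T * W.bulge_block k (f_U X (k + 2)) (phi_U X (k + 2)) (c_seq X (k + 2)) (theta X (k + 2)) *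
          Z (Suc k)) $$ (i, 0) = 0" .
    qed (unfold eqs, fact upd[THEN conjunct1], fact upd[THEN conjunct2, THEN conjunct1],
        fact upd[THEN conjunct2, THEN conjunct2, THEN conjunct1])
    moreover have "Suc k < N" using k by simp
    moreover have "f_B X (k + 3) = f_U X (k + 3) - outer_prod (c_seq X (k + 3)) (theta X (k + 3))"
      "phi_B X (k + 3) = phi_U X (k + 3)"
      by (rule upd[THEN conjunct2, THEN conjunct2, THEN conjunct2, THEN conjunct1],
          rule upd[THEN conjunct2, THEN conjunct2, THEN conjunct2, THEN conjunct2])
    moreover have "Suc k + 2 = k + 3" by simp
    ultimately show ?case by (simp only: S_Suc)
  qed
  have N2: "N - 2 + 2 = N" "N - 2 + 0 + 2 = N" "Suc (N - 2) = N - 1" using N by simp_all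
  have last': "W.tracks (N - 2) (?S (N - 2)) (f_U X N) (phi_U X N) (c_seq X N) (theta X N)"
    "f_B X N = f_U X N - outer_prod (c_seq X N) (theta X N)"
    using chase[OF order_refl, unfolded N2(1)] by blast+
  have QZ: "Q (N - 1) \<in> carrier_mat 2 2" "Z (N - 1) \<in> carrier_mat 2 2"
    using rotQ.carrier_2 rotZ.carrier_2 by simp_all
  have S: "?S (N - 2) \<in> carrier_mat N N" by (rule W.tracksD(1)[OF last'(1)])
  have fB: "f_B X N \<in> carrier_mat 2 2" "\<And>a e. a < 2 \<Longrightarrow> e < 2 \<Longrightarrow> f_B X N $$ (a, e) = ?S (N - 2) $$ (N - 2 + 0 + a, N - 2 + e)"
    using W.tracksD(2-5)[OF last'(1)] W.tracksD(8)[OF last'(1)]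
    unfolding last'(2) by (simp_all add: minus_carrier_mat)
  have final: "((place N (N - 2 + 0) (Q (N - 1)))\<^sup>T * ?S (N - 2) * place N (N - 2) (Z (N - 1))) $$ (i, j) = 0"
    if "i < N" "j < N" "j < i" for i j
  proof (rule bulge_moves_down[OF S QZ(1) _ QZ(2)])
    fix i :: nat assume i: "1 \<le> i" "i < 2"
    obtain x where "mat_of_rows 2 [row ((Q (N - 1))\<^sup>T * f_B X N) 1] * Z (N - 1) = mat_of_rows_list 2 [[0, x]]"
      using last by (auto simp: choose_last_Z_def Let_def)
    then have "(mat_of_rows 2 [row ((Q (N - 1))\<^sup>T * f_B X N) 1] * Z (N - 1)) $$ (0, 0) = 0"
      by (simp add: mat_of_rows_list_def)
    moreover have "(mat_of_rows 2 [row ((Q (N - 1))\<^sup>T * f_B X N) 1] * Z (N - 1)) $$ (0, 0) =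
        ((Q (N - 1))\<^sup>T * f_B X N * Z (N - 1)) $$ (i, 0)"
      using i QZ fB(1)
      by (auto simp: mat_of_rows_def scalar_prod_def less_Suc_eq numeral_2_eq_2 algebra_simps)
    moreover have "((Q (N - 1))\<^sup>T * f_B X N * Z (N - 1)) $$ (i, 0) =
        (\<Sum>a<2. \<Sum>l<2. Q (N - 1) $$ (a, i) * f_B X N $$ (a, l) * Z (N - 1) $$ (l, 0))"
      using i by (intro index_two_sided_sum QZ fB(1)) simp_all
    ultimately show "(\<Sum>a<2. \<Sum>l<2. Q (N - 1) $$ (a, i) * ?S (N - 2) $$ (N - 2 + 0 + a, N - 2 + l) *
        Z (N - 1) $$ (l, 0)) = 0"
      by (simp add: fB(2))
  qed (use that N2 W.tracksD(6)[OF last'(1)] in auto)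
  have "(accumulate N Q)\<^sup>T * B * accumulate N Z = ?S (Suc (N - 2))"
    using N accumulate_eq_partial[of N] N2 by simp
  also have "\<dots> = (place N (N - 2 + 0) (Q (N - 1)))\<^sup>T * ?S (N - 2) * place N (N - 2) (Z (N - 1))"
    using S_Suc[of "N - 2"] N unfolding N2 by simp
  finally show ?thesis
    using final S by (intro upper_triangularI) simp
qed

section \<open>The Hessenberg matrix\<close>

lemma three_cells_index:
  fixes u v t :: "real mat"
  assumes "u \<in> carrier_mat 1 1" "v \<in> carrier_mat 1 1" "t \<in> carrier_mat 1 n"
  shows "u @\<^sub>c v @\<^sub>c t \<in> carrier_mat 1 (2 + n)"
    and "(u @\<^sub>c v @\<^sub>c t) $$ (0, 0) = u $$ (0, 0)"
    and "(u @\<^sub>c v @\<^sub>c t) $$ (0, 1) = v $$ (0, 0)"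
    and "\<And>j. j < n \<Longrightarrow> (u @\<^sub>c v @\<^sub>c t) $$ (0, j + 2) = t $$ (0, j)"
proof -
  have vt: "v @\<^sub>c t \<in> carrier_mat 1 (1 + n)" using append_cols_carrier[OF assms(2,3)] .
  show "u @\<^sub>c v @\<^sub>c t \<in> carrier_mat 1 (2 + n)" using append_cols_carrier[OF assms(1) vt] by simp
  note idx = append_cols_index[OF assms(1) vt] append_cols_index[OF assms(2,3)]
  show "(u @\<^sub>c v @\<^sub>c t) $$ (0, 0) = u $$ (0, 0)" "(u @\<^sub>c v @\<^sub>c t) $$ (0, 1) = v $$ (0, 0)"
    "\<And>j. j < n \<Longrightarrow> (u @\<^sub>c v @\<^sub>c t) $$ (0, j + 2) = t $$ (0, j)"
    by (simp_all add: idx)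
qed

lemma three_rows_index:
  fixes u v t :: "real mat"
  assumes "u \<in> carrier_mat 1 n" "v \<in> carrier_mat 1 n" "t \<in> carrier_mat 1 n"
  shows "u @\<^sub>r v @\<^sub>r t \<in> carrier_mat 3 n"
    and "\<And>j. j < n \<Longrightarrow> (u @\<^sub>r v @\<^sub>r t) $$ (0, j) = u $$ (0, j)"
    and "\<And>j. j < n \<Longrightarrow> (u @\<^sub>r v @\<^sub>r t) $$ (1, j) = v $$ (0, j)"
    and "\<And>j. j < n \<Longrightarrow> (u @\<^sub>r v @\<^sub>r t) $$ (2, j) = t $$ (0, j)"
proof -
  have vt: "v @\<^sub>r t \<in> carrier_mat (1 + 1) n" using carrier_append_rows[OF assms(2,3)] .
  show "u @\<^sub>r v @\<^sub>r t \<in> carrier_mat 3 n"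
    using carrier_append_rows[OF assms(1) vt] by (simp add: numeral_3_eq_3)
  note idx = append_rows_index[OF assms(1) vt] append_rows_index[OF assms(2,3)]
  show "\<And>j. j < n \<Longrightarrow> (u @\<^sub>r v @\<^sub>r t) $$ (0, j) = u $$ (0, j)"
    "\<And>j. j < n \<Longrightarrow> (u @\<^sub>r v @\<^sub>r t) $$ (1, j) = v $$ (0, j)"
    "\<And>j. j < n \<Longrightarrow> (u @\<^sub>r v @\<^sub>r t) $$ (2, j) = t $$ (0, j)"
    by (simp_all add: idx)
qed

text \<open>
  The chase on \<open>A\<close> starts after the rotation \<open>Q\<^sub>1\<close>, which creates the first bulge; thus the left
  rotations are always one step ahead of the right ones. At the end, \<open>Q\<^bsub>N-1\<^esub>\<close> removes the bulge
  from a block with two rows and three columns, and \<open>Z\<^bsub>N-1\<^esub>\<close> combines the last two columns, which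
  keeps a matrix upper Hessenberg.
\<close>

lemma upper_hessenberg_result:
  fixes N :: nat and A B V :: "real mat"
  assumes N: "3 \<le> N"
    and A: "A \<in> carrier_mat N N" "upper_hessenberg A"
    and V: "V \<in> carrier_mat N N" and z: "z \<in> carrier_vec N" and w: "w \<in> carrier_vec N"
    and AV: "A = V - outer_prod z w"
    and gens: "upper_triangular_generators N V GV"
    and D: "D = input_of A B GV GU z w p q"
    and rotQ: "rotation_sequence N Q" and rotZ: "rotation_sequence N Z"
    and prep: "prepare_V_A D (Q 1) X"
    and choose: "\<And>k. 1 \<le> k \<Longrightarrow> k \<le> N - 3 \<Longrightarrow> choose_Q D X k (Z k) (Q (k + 1))"
    and last: "choose_last_Q N D X (Z (N - 2)) (Q (N - 1))"
    and update: "\<And>k. 1 \<le> k \<Longrightarrow> k \<le> N - 3 \<Longrightarrow> update_V_A D X k (Q (k + 1)) (Z k)"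
  shows "upper_hessenberg ((accumulate N Q)\<^sup>T * A * accumulate N Z)"
proof -
  interpret rotQ: rotation_sequence N Q by (rule rotQ)
  interpret rotZ: rotation_sequence N Z by (rule rotZ)
  let ?r = "gen_r GV" and ?g = "gen_g GV" and ?h = "gen_h GV" and ?b = "gen_b GV"
  have g: "\<And>i. 1 \<le> i \<Longrightarrow> i \<le> N \<Longrightarrow> ?g i \<in> carrier_mat 1 (?r i)"
    and h: "\<And>j. 1 \<le> j \<Longrightarrow> j \<le> N \<Longrightarrow> ?h j \<in> carrier_mat (?r j) 1"
    and b: "\<And>k. 1 \<le> k \<Longrightarrow> k < N \<Longrightarrow> ?b k \<in> carrier_mat (?r k) (?r (Suc k))"
    and "\<And>i j. 1 \<le> i \<Longrightarrow> i \<le> j \<Longrightarrow> j \<le> N \<Longrightarrow>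
      scalar_mat (V\<langle>i,j\<rangle>) = ?g i * ordered_prod (?r i) ?b i j * ?h j"
    using gens unfolding upper_triangular_generators_def by auto
  then have V_index: "V $$ (i - 1, j - 1) = (?g i * ordered_prod (?r i) ?b i j * ?h j) $$ (0, 0)"
    if "1 \<le> i" "i \<le> j" "j \<le> N" for i j
    using that by (metis scalar_mat_index)
  have A_index: "A $$ (i, j) = V $$ (i, j) - z $ i * w $ j" if "i < N" "j < N" for i j
    using that V z w by (auto simp: AV)
  have hess: "A $$ (i, j) = 0" if "i < N" "j + 1 < i" for i j
    using that A by (auto simp: upper_hessenberg_def)
  interpret W: rank_one_corrected N 1 A ?r "\<lambda>m. ?g (Suc m)" ?h ?b z w
  proof
    show "A $$ (i, j) = 0" if "i < N" "j < N" "j + 1 < i" for i j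
      using hess that by auto
    show "A $$ (m + 1 - 1, j - 1) = (?g (Suc m) * ordered_prod (?r (Suc m)) ?b (Suc m) j * ?h j) $$ (0, 0) -
        z $ (m + 1 - 1) * w $ (j - 1)" if "2 \<le> m" "m + 1 \<le> N" "m < j" "j \<le> N" for m j
      using that A_index[of m "j - 1"] V_index[of "Suc m" j] by simp
  qed (use N A z w g h b in auto)
  have Q1: "Q 1 \<in> carrier_mat 3 3" using rotQ.carrier_3[of 1] N by simp
  \<comment> \<open>The first two columns of \<open>Y\<close> are those of the first three rows of \<open>V\<close>; its entries below the diagonal
    are known from \<open>A\<close> and the rank one term. The other columns generate the rest of these rows.\<close>
  define Y where "Y = (?g 1 * ?h 1 @\<^sub>c ?g 1 * ?b 1 * ?h 2 @\<^sub>c ?g 1 * ?b 1 * ?b 2) @\<^sub>r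
             (scalar_mat (A $$ (1, 0) + z $ 1 * w $ 0) @\<^sub>c ?g 2 * ?h 2 @\<^sub>c ?g 2 * ?b 2) @\<^sub>r
             (scalar_mat (z $ 2 * w $ 0) @\<^sub>c scalar_mat (A $$ (2, 1) + z $ 2 * w $ 1) @\<^sub>c ?g 3)"
  have car: "?g 1 \<in> carrier_mat 1 (?r 1)" "?g 2 \<in> carrier_mat 1 (?r 2)" "?g 3 \<in> carrier_mat 1 (?r 3)"
    "?h 1 \<in> carrier_mat (?r 1) 1" "?h 2 \<in> carrier_mat (?r 2) 1"
    "?b 1 \<in> carrier_mat (?r 1) (?r 2)" "?b 2 \<in> carrier_mat (?r 2) (?r 3)"
    using g[of 1] g[of 2] g[of 3] h[of 1] h[of 2] b[of 1] b[of 2] N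
    by (simp_all add: numeral_2_eq_2 numeral_3_eq_3)
  have gb1: "?g 1 * ?b 1 \<in> carrier_mat 1 (?r 2)" and gbb1: "?g 1 * ?b 1 * ?b 2 \<in> carrier_mat 1 (?r 3)"
    and gb2: "?g 2 * ?b 2 \<in> carrier_mat 1 (?r 3)"
    and gh: "?g 1 * ?h 1 \<in> carrier_mat 1 1" "?g 1 * ?b 1 * ?h 2 \<in> carrier_mat 1 1" "?g 2 * ?h 2 \<in> carrier_mat 1 1"
    using car by (auto intro!: mult_carrier_mat)
  note cells0 = three_cells_index[OF gh(1,2) gbb1]
  note cells1 = three_cells_index[OF scalar_mat_carrier[of "A $$ (1, 0) + z $ 1 * w $ 0"] gh(3) gb2]
  note cells2 = three_cells_index[OF scalar_mat_carrier[of "z $ 2 * w $ 0"]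
      scalar_mat_carrier[of "A $$ (2, 1) + z $ 2 * w $ 1"] car(3)]
  note rows = three_rows_index[OF cells0(1) cells1(1) cells2(1), folded Y_def]
  have start: "W.tracks 0 ((place N 0 (Q 1))\<^sup>T * A) (f_V X 3) (phi_V X 3) (chi X 3) (gam X 2)"
  proof -
    let ?S = "(place N 0 (Q 1))\<^sup>T * A"
    have eqs: "1 - 1 = (0::nat)" "2 - 1 = (1::nat)" "3 - 1 = (2::nat)" "1 + 1 = (2::nat)" "2 + 1 = (3::nat)"
      by simp_all
    note prep' = prep[unfolded prepare_V_A_def D input_of_simps sigma_V_def eqs, folded Y_def]
    have \<chi>: "chi X 3 = vec_last ((Q 1)\<^sup>T *\<^sub>v vec_of_list [z $ 0, z $ 1, z $ 2]) 2"
      and \<gamma>: "gam X 2 = vec_of_list [w $ 0, w $ 1]"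
      by (rule prep'[THEN conjunct2, THEN conjunct1], rule prep'[THEN conjunct2, THEN conjunct2, THEN conjunct1])
    have T_car: "(Q 1)\<^sup>T * Y \<in> carrier_mat 3 (2 + ?r 3)" using Q1 rows(1) by simp
    have T_index: "((Q 1)\<^sup>T * Y) $$ (i, j) = (\<Sum>l<3. Q 1 $$ (l, i) * Y $$ (l, j))"
      if "i < 3" "j < 2 + ?r 3" for i j
      using that Q1 rows(1) by (subst index_mult_sum[of _ 3 3 _ "2 + ?r 3"]) auto
    have "f_V X 3 = mat 2 2 (\<lambda>(i, j). ((Q 1)\<^sup>T * Y) $$ (i + 1, j + 0))"
      "phi_V X 3 = mat 2 (?r 3) (\<lambda>(i, j). ((Q 1)\<^sup>T * Y) $$ (i + 1, j + 0 + 2))"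
    proof -
      have "dim_row ((Q 1)\<^sup>T * Y) = 3" "dim_col ((Q 1)\<^sup>T * Y) = 0 + 2 + ?r 3"
        using carrier_matD[OF T_car] by simp_all
      note split = split_trailing_block[OF conjunct1[OF prep'] this]
      show "f_V X 3 = mat 2 2 (\<lambda>(i, j). ((Q 1)\<^sup>T * Y) $$ (i + 1, j + 0))"
        "phi_V X 3 = mat 2 (?r 3) (\<lambda>(i, j). ((Q 1)\<^sup>T * Y) $$ (i + 1, j + 0 + 2))"
        by (fact split)+
    qed
    then have f: "f_V X 3 = mat 2 2 (\<lambda>(i, j). \<Sum>l<3. Q 1 $$ (l, i + 1) * Y $$ (l, j))"
      and \<phi>: "phi_V X 3 = mat 2 (?r 3) (\<lambda>(i, j). \<Sum>l<3. Q 1 $$ (l, i + 1) * Y $$ (l, j + 2))"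
      by (auto intro!: eq_matI simp: T_index[unfolded One_nat_def] simp del: index_mult_mat)
    have Y_left: "Y $$ (l, e) = V $$ (l, e)" if l: "l < 3" and e: "e < 2" for l e
    proof -
      have "?g 1 * ordered_prod (?r 1) ?b 1 1 * ?h 1 = ?g 1 * ?h 1"
        "?g 2 * ordered_prod (?r 2) ?b 2 2 * ?h 2 = ?g 2 * ?h 2"
        "ordered_prod (?r 1) ?b 1 2 = ?b 1"
        using car ordered_prod_Suc[of 1 1 "?r 1" ?b] by (simp_all add: numeral_2_eq_2)
      then have "V $$ (0, 0) = (?g 1 * ?h 1) $$ (0, 0)" "V $$ (1, 1) = (?g 2 * ?h 2) $$ (0, 0)"
        "V $$ (0, 1) = (?g 1 * ?b 1 * ?h 2) $$ (0, 0)"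
        using V_index[of 1 1] V_index[of 2 2] V_index[of 1 2] N by simp_all
      moreover have "V $$ (1, 0) = A $$ (1, 0) + z $ 1 * w $ 0" "V $$ (2, 1) = A $$ (2, 1) + z $ 2 * w $ 1"
        "V $$ (2, 0) = z $ 2 * w $ 0"
        using A_index[of 1 0] A_index[of 2 1] A_index[of 2 0] hess[of 2 0] N by simp_all
      moreover have "(l, e) \<in> {(0, 0), (0, 1), (1, 0), (1, 1), (2, 0), (2, 1)}" using l e by auto
      ultimately show ?thesis
        using rows(2,3,4)[of e] e cells0(2,3) cells1(2,3) cells2(2,3)
        by (auto simp del: One_nat_def)
    qed
    have Y_right: "V $$ (l, j - 1) = (\<Sum>k<?r 3. Y $$ (l, k + 2) * (ordered_prod (?r 3) ?b 3 j * ?h j) $$ (k, 0))"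
      if l: "l < 3" and j: "3 \<le> j" "j \<le> N" for l j
    proof -
      define P where "P = ordered_prod (?r 3) ?b 3 j"
      have P: "P \<in> carrier_mat (?r 3) (?r j)" and hj: "?h j \<in> carrier_mat (?r j) 1"
        using W.generator_tail_carrier(1)[of 3 j] h[of j] j by (simp_all add: P_def)
      have Ph: "P * ?h j \<in> carrier_mat (?r 3) 1" using P hj by simp
      have P2: "ordered_prod (?r 2) ?b 2 j = ?b 2 * P"
        unfolding P_def using ordered_prod_peel_left[of 2 j ?b ?r] b j by (simp add: numeral_3_eq_3 numeral_2_eq_2)
      have P1: "ordered_prod (?r 1) ?b 1 j = ?b 1 * (?b 2 * P)"
        using ordered_prod_peel_left[of 1 j ?b ?r] b j P2 by (simp add: numeral_2_eq_2)
      have bP: "?b 2 * P \<in> carrier_mat (?r 2) (?r j)" using car P by simp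
      have "?g 1 * ordered_prod (?r 1) ?b 1 j * ?h j = ?g 1 * ?b 1 * ?b 2 * (P * ?h j)"
        unfolding P1 assoc_mult_mat[OF car(1,6) bP, symmetric] assoc_mult_mat[OF gb1 car(7) P, symmetric]
        by (rule assoc_mult_mat[OF gbb1 P hj])
      then have V0: "V $$ (0, j - 1) = (?g 1 * ?b 1 * ?b 2 * (P * ?h j)) $$ (0, 0)"
        using V_index[of 1 j] j by simp
      have "?g 2 * ordered_prod (?r 2) ?b 2 j * ?h j = ?g 2 * ?b 2 * (P * ?h j)"
        unfolding P2 assoc_mult_mat[OF car(2,7) P, symmetric] by (rule assoc_mult_mat[OF gb2 P hj])
      then have V1: "V $$ (1, j - 1) = (?g 2 * ?b 2 * (P * ?h j)) $$ (0, 0)"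
        using V_index[of 2 j] j by simp
      have "?g 3 * ordered_prod (?r 3) ?b 3 j * ?h j = ?g 3 * (P * ?h j)"
        unfolding P_def[symmetric] by (rule assoc_mult_mat[OF car(3) P hj])
      then have V2: "V $$ (2, j - 1) = (?g 3 * (P * ?h j)) $$ (0, 0)"
        using V_index[of 3 j] j by simp
      have one: "(0::nat) < 1" by simp
      have "l \<in> {0, 1, 2}" using l by auto
      then show ?thesis
        unfolding P_def[symmetric]
        using V0 V1 V2 index_mult_sum[OF gbb1 Ph one one] index_mult_sum[OF gb2 Ph one one]
          index_mult_sum[OF car(3) Ph one one] rows(2,3,4) cells0(4) cells1(4) cells2(4)
        by (auto simp del: index_mult_mat One_nat_def)
    qed
    have \<chi>_index: "chi X 3 $ a = (\<Sum>l<3. Q 1 $$ (l, Suc a) * z $ l)" if "a < 2" for a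
    proof -
      have "vec_of_list [z $ 0, z $ 1, z $ 2] \<in> carrier_vec 3" by (rule carrier_vecI) simp
      from vec_last_index[OF Q1 this that] show ?thesis
        unfolding \<chi> by (simp add: eval_nat_numeral)
    qed
    have S_index: "?S $$ (i, j) = (if i < 3 then \<Sum>l<3. Q 1 $$ (l, i) * A $$ (l, j) else A $$ (i, j))"
      if "i < N" "j < N" for i j
      using place_transpose_mult_index[OF Q1 _ A(1) that, of 0] N by simp
    have S_V: "?S $$ (1 + a, j) = (\<Sum>l<3. Q 1 $$ (l, Suc a) * V $$ (l, j)) - chi X 3 $ a * w $ j"
      if "a < 2" "j < N" for a j
    proof -
      have "?S $$ (1 + a, j) = (\<Sum>l<3. Q 1 $$ (l, Suc a) * V $$ (l, j) - Q 1 $$ (l, Suc a) * z $ l * w $ j)"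
        using S_index[of "1 + a" j] that N by (simp add: A_index algebra_simps)
      then show ?thesis using that by (simp add: sum_subtractf \<chi>_index sum_distrib_right)
    qed
    have \<gamma>_index: "gam X 2 $ e = w $ e" if "e < 2" for e
      using that by (auto simp: \<gamma> less_2_cases_iff)
    have \<phi>_car: "phi_V X 3 \<in> carrier_mat 2 (?r 3)" and f_car: "f_V X 3 \<in> carrier_mat 2 2" by (simp_all add: \<phi> f)
    have vec_car: "chi X 3 \<in> carrier_vec 2" "gam X 2 \<in> carrier_vec 2"
      unfolding \<chi> \<gamma> by (simp_all add: vec_last_def carrier_vecI)
    have S_car: "?S \<in> carrier_mat N N" using A by (meson mult_carrier_mat place_carrier transpose_carrier_mat)
    show ?thesis
      unfolding W.tracks_def add_0 add_0_right
    proof (intro conjI allI impI)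
      show "?S $$ (i, j) = 0" if "i < N" "j < N" "j + 1 < i" "(i, j) \<noteq> (1 + 1, 0)" for i j
        using that hess[of i j] S_index[of i j] by auto
      show "?S $$ (i, j) = A $$ (i, j)" if "i < N" "j < N" "1 + 2 \<le> i" for i j
        using that S_index[of i j] by simp
      show "?S $$ (1 + a, e) = f_V X 3 $$ (a, e) - chi X 3 $ a * gam X 2 $ e" if "a < 2" "e < 2" for a e
        using that S_V[of a e] N \<gamma>_index[of e] by (simp add: f Y_left)
      show "?S $$ (1 + a, j - 1) = (phi_V X 3 * ordered_prod (?r 3) ?b 3 j * ?h j) $$ (a, 0) -
          chi X 3 $ a * w $ (j - 1)" if a: "a < 2" and j: "3 \<le> j" "j \<le> N" for a j
      proof -
        let ?Y = "ordered_prod (?r 3) ?b 3 j * ?h j"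
        have P: "ordered_prod (?r 3) ?b 3 j \<in> carrier_mat (?r 3) (?r j)" "?h j \<in> carrier_mat (?r j) 1"
          and Ycar: "?Y \<in> carrier_mat (?r 3) 1"
          using W.generator_tail_carrier[of 3 j] h[of j] j by simp_all
        have "(\<Sum>l<3. Q 1 $$ (l, Suc a) * V $$ (l, j - 1)) =
            (\<Sum>l<3. \<Sum>k<?r 3. Q 1 $$ (l, Suc a) * Y $$ (l, k + 2) * ?Y $$ (k, 0))"
          by (intro sum.cong refl) (simp only: Y_right[OF _ j] sum_distrib_left mult.assoc lessThan_iff)
        also have "\<dots> = (\<Sum>k<?r 3. \<Sum>l<3. Q 1 $$ (l, Suc a) * Y $$ (l, k + 2) * ?Y $$ (k, 0))"
          by (rule sum.swap)
        also have "\<dots> = (\<Sum>k<?r 3. phi_V X 3 $$ (a, k) * ?Y $$ (k, 0))"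
          using a by (intro sum.cong refl) (simp add: \<phi> sum_distrib_right)
        also have "\<dots> = (phi_V X 3 * ?Y) $$ (a, 0)"
          using index_mult_sum[OF \<phi>_car Ycar a, of 0] by simp
        also have "phi_V X 3 * ?Y = phi_V X 3 * ordered_prod (?r 3) ?b 3 j * ?h j"
          using assoc_mult_mat[OF \<phi>_car P] by simp
        finally show ?thesis using S_V[of a "j - 1"] a j by simp
      qed
    qed (rule S_car \<phi>_car f_car vec_car)+
  qed
  let ?S = "\<lambda>k. (partial_accumulate N Q (Suc k))\<^sup>T * A * partial_accumulate N Z k"
  have S_Suc: "?S (Suc k) = (place N (k + 1) (Q (k + 2)))\<^sup>T * ?S k * place N k (Z (Suc k))" if k: "k + 2 < N" for k
  proof -
    have k': "Suc (Suc k) < N" "Suc k < N" using k by simp_all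
    have "?S (Suc k) = (place N (Suc k) (Q (Suc (Suc k))))\<^sup>T * ?S k * place N k (Z (Suc k))"
      unfolding rotQ.partial_accumulate_step[OF k'(1)] rotZ.partial_accumulate_step[OF k'(2)]
      using k' A(1) rotQ.partial_accumulate_carrier[of "Suc k"] rotZ.partial_accumulate_carrier[of k]
      by (intro two_sided_step[where N = N]) simp_all
    then show ?thesis by simp
  qed
  have chase: "W.tracks k (?S k) (f_V X (k + 3)) (phi_V X (k + 3)) (chi X (k + 3)) (gam X (k + 2)) \<and>
      f_A X (k + 3) = f_V X (k + 3) - outer_prod (chi X (k + 3)) (gam X (k + 2)) \<and>
      phi_A X (k + 3) = phi_V X (k + 3)"
    if "k + 3 \<le> N" for k
    using that
  proof (induction k)
    case 0
    have "f_A X 3 = f_V X 3 - outer_prod (chi X 3) (gam X 2)" "phi_A X 3 = phi_V X 3"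
      by (rule prep[unfolded prepare_V_A_def, THEN conjunct2, THEN conjunct2, THEN conjunct2, THEN conjunct1],
          rule prep[unfolded prepare_V_A_def, THEN conjunct2, THEN conjunct2, THEN conjunct2, THEN conjunct2])
    moreover have "?S 0 = (place N 0 (Q 1))\<^sup>T * A"
      using rotQ.partial_accumulate_step[of 0] N A(1) by (simp add: left_mult_one_mat[of _ N N])
    ultimately show ?case using start by (simp only: add_0)
  next
    case (Suc k)
    have k: "Suc k \<le> N - 3" "k + 1 + 2 < N" "k + 2 < N" using Suc.prems N by simp_all
    have eqs: "Suc k + 1 = k + 2" "Suc k + 2 = k + 3" "Suc k + 3 = k + 4" "k + 3 - 1 = k + 2" "k + 3 + 1 = k + 4"
      "k + 1 + 2 = k + 3" "k + 4 - 1 = k + 3" "Suc (k + 3) = k + 4"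
      by simp_all
    note D_simps = D input_of_simps sigma_V_def
    have le: "1 \<le> Suc k" by simp
    note upd = update[OF le k(1), unfolded update_V_A_def D_simps eqs]
    note ch = choose[OF le k(1), unfolded choose_Q_def eps_A_def D_simps eqs Let_def]
    have QZ: "Q (k + 2) \<in> carrier_mat 3 3" "Z (Suc k) \<in> carrier_mat 3 3"
      using rotQ.carrier_3[of "k + 2"] rotZ.carrier_3[of "Suc k"] k by simp_all
    have IH: "W.tracks k (?S k) (f_V X (k + 3)) (phi_V X (k + 3)) (chi X (k + 3)) (gam X (k + 2))"
      "f_A X (k + 3) = f_V X (k + 3) - outer_prod (chi X (k + 3)) (gam X (k + 2))"
      "phi_A X (k + 3) = phi_V X (k + 3)"
      using Suc by auto
    have block: "W.bulge_block k (f_V X (k + 3)) (phi_V X (k + 3)) (chi X (k + 3)) (gam X (k + 2)) \<in> carrier_mat 3 3"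
      by (rule W.bulge_block_carrier[OF IH(1)])
    have "W.tracks (Suc k) ((place N (k + 1) (Q (k + 2)))\<^sup>T * ?S k * place N k (Z (Suc k)))
      (f_V X (k + 4)) (phi_V X (k + 4)) (chi X (k + 4)) (gam X (k + 3))"
    proof (rule W.tracks_step[OF IH(1) k(2) QZ])
      fix i :: nat assume i: "1 \<le> i" "i < 3"
      have W: "W.bulge_block k (f_V X (k + 3)) (phi_V X (k + 3)) (chi X (k + 3)) (gam X (k + 2)) =
          four_block_mat (f_A X (k + 3))
            (phi_A X (k + 3) * ?h (k + 3) - mat_of_cols 2 [w $ (k + 2) \<cdot>\<^sub>v chi X (k + 3)])
            (0\<^sub>m 1 2) (scalar_mat (A $$ (k + 3, k + 2)))"
        unfolding W.bulge_block_def IH(2,3) eqs ..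
      obtain u where "(Q (k + 2))\<^sup>T *\<^sub>v col
          (W.bulge_block k (f_V X (k + 3)) (phi_V X (k + 3)) (chi X (k + 3)) (gam X (k + 2)) * Z (Suc k)) 0 =
          vec_of_list [u, 0, 0]"
        using ch unfolding W by blast
      then show "((Q (k + 2))\<^sup>T * W.bulge_block k (f_V X (k + 3)) (phi_V X (k + 3)) (chi X (k + 3)) (gam X (k + 2)) *
          Z (Suc k)) $$ (i, 0) = 0"
        using i by (subst eliminated_column[OF QZ(1) block QZ(2)]) (auto simp: less_Suc_eq eval_nat_numeral)
    qed (unfold eqs, fact upd[THEN conjunct1], fact upd[THEN conjunct2, THEN conjunct1],
        fact upd[THEN conjunct2, THEN conjunct2, THEN conjunct1])
    moreover have "f_A X (k + 4) = f_V X (k + 4) - outer_prod (chi X (k + 4)) (gam X (k + 3))"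
      "phi_A X (k + 4) = phi_V X (k + 4)"
      by (rule upd[THEN conjunct2, THEN conjunct2, THEN conjunct2, THEN conjunct1],
          rule upd[THEN conjunct2, THEN conjunct2, THEN conjunct2, THEN conjunct2])
    ultimately show ?case unfolding S_Suc[OF k(3)] eqs by blast
  qed
  obtain K where K: "N = K + 3" using N by (metis add.commute le_Suc_ex)
  have K2: "K + 2 < N" by (simp add: K)
  have last': "W.tracks K (?S K) (f_V X N) (phi_V X N) (chi X N) (gam X (K + 2))"
    "f_A X N = f_V X N - outer_prod (chi X N) (gam X (K + 2))" "phi_A X N = phi_V X N"
    using chase[of K] by (simp_all add: K)
  have QZ: "Q (K + 2) \<in> carrier_mat 2 2" "Z (Suc K) \<in> carrier_mat 3 3"
    using rotQ.carrier_2 rotZ.carrier_3[of "Suc K"] by (simp_all add: K)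
  have S: "?S K \<in> carrier_mat N N" by (rule W.tracksD(1)[OF last'(1)])
  \<comment> \<open>The last block has no bordering row, since the window has reached the last row.\<close>
  define \<Omega> where "\<Omega> = f_A X N @\<^sub>c eps_A D X N"
  have eps: "eps_A D X N = phi_V X N * ?h (K + 3) - mat_of_cols 2 [w $ (K + 2) \<cdot>\<^sub>v chi X N]"
    unfolding eps_A_def D input_of_simps last'(3) by (simp add: K)
  have fA: "f_A X N \<in> carrier_mat 2 2"
    using W.tracksD(2-5)[OF last'(1)] unfolding last'(2) by (simp add: minus_carrier_mat)
  have eps_car: "eps_A D X N \<in> carrier_mat 2 1"
    unfolding eps by (rule minus_carrier_mat, rule carrier_matI) simp_all
  have \<Omega>_car: "\<Omega> \<in> carrier_mat 2 3"
    using append_cols_carrier[OF fA eps_car] by (simp add: \<Omega>_def)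
  have \<Omega>_index: "\<Omega> $$ (a, l) = ?S K $$ (K + 1 + a, K + l)" if a: "a < 2" and l: "l < 3" for a l
  proof -
    have idx: "\<Omega> $$ (a, l) = (if l < 2 then f_A X N $$ (a, l) else eps_A D X N $$ (a, l - 2))"
      unfolding \<Omega>_def using a l by (intro append_cols_index[OF fA eps_car]) simp_all
    show ?thesis
    proof (cases "l < 2")
      case True
      then show ?thesis using idx W.tracksD(2-5)[OF last'(1)] W.tracksD(8)[OF last'(1) a True] a unfolding last'(2) by simp
    next
      case False
      then have "l = 2" using l by simp
      then show ?thesis using idx W.next_column_index[OF last'(1) K2 a, folded eps] by simp
    qed
  qed
  have band: "?S (Suc K) $$ (i, j) = 0" if "i < N" "j < N" "j + 1 < i" for i j
    unfolding S_Suc[OF K2]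
  proof (rule bulge_moves_down[OF S QZ(1) _ QZ(2)])
    fix i :: nat assume i: "1 \<le> i" "i < 2"
    obtain u where "(Q (K + 2))\<^sup>T *\<^sub>v col (\<Omega> * Z (Suc K)) 0 = vec_of_list [u, 0]"
      using last by (auto simp: choose_last_Q_def Let_def \<Omega>_def K)
    then have "((Q (K + 2))\<^sup>T * \<Omega> * Z (Suc K)) $$ (i, 0) = 0"
      using i by (subst eliminated_column[OF QZ(1) \<Omega>_car QZ(2)]) (auto simp: less_Suc_eq eval_nat_numeral)
    moreover have "((Q (K + 2))\<^sup>T * \<Omega> * Z (Suc K)) $$ (i, 0) =
        (\<Sum>a<2. \<Sum>l<3. Q (K + 2) $$ (a, i) * \<Omega> $$ (a, l) * Z (Suc K) $$ (l, 0))"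
      using i by (intro index_two_sided_sum QZ \<Omega>_car) simp_all
    ultimately show "(\<Sum>a<2. \<Sum>l<3. Q (K + 2) $$ (a, i) * ?S K $$ (K + 1 + a, K + l) * Z (Suc K) $$ (l, 0)) = 0"
      by (simp add: \<Omega>_index)
  qed (use that K W.tracksD(6)[OF last'(1)] in auto)
  have S': "?S (Suc K) \<in> carrier_mat N N"
    using A(1) rotQ.partial_accumulate_carrier[of "Suc (Suc K)"] rotZ.partial_accumulate_carrier[of "Suc K"]
    by (simp add: K mult_carrier_mat[of _ "K + 3" "K + 3"])
  have ZK: "Z (K + 2) \<in> carrier_mat 2 2" using rotZ.carrier_2 by (simp add: K)
  have acc: "(accumulate N Q)\<^sup>T * A * accumulate N Z = ?S (Suc K) * place N (Suc K) (Z (K + 2))"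
  proof -
    have "N - 1 = Suc (Suc K)" by (simp add: K)
    then have "(accumulate N Q)\<^sup>T * A * accumulate N Z = (partial_accumulate N Q (Suc (Suc K)))\<^sup>T * A *
        (partial_accumulate N Z (Suc K) * place N (Suc K) (Z (K + 2)))"
      using accumulate_eq_partial[of N] N rotZ.partial_accumulate_step[of "Suc K"] by (simp add: K)
    moreover have "(partial_accumulate N Q (Suc (Suc K)))\<^sup>T * A \<in> carrier_mat N N"
      using A(1) rotQ.partial_accumulate_carrier[of "Suc (Suc K)"] by (simp add: K)
    moreover have "partial_accumulate N Z (Suc K) \<in> carrier_mat N N"
      using rotZ.partial_accumulate_carrier[of "Suc K"] by (simp add: K)
    ultimately show ?thesis by (simp only: assoc_mult_mat[OF _ _ place_carrier])
  qed
  have "(?S (Suc K) * place N (Suc K) (Z (K + 2))) $$ (i, j) = 0" if "i < N" "j + 1 < i" for i j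
  proof -
    have "j < N" "j \<notin> {Suc K..<Suc K + 2}" using that K by auto
    then show ?thesis
      using mult_place_index[OF ZK _ S' that(1), of "Suc K" j] band[of i j] that K by simp
  qed
  then show ?thesis unfolding upper_hessenberg_def acc using carrier_matD(1)[OF S'] by simp
qed

section \<open>The double-shift step\<close>

theorem theorem1:
  fixes N :: nat
    and A B V U P :: "real mat"
    and z w p q :: "real vec"
    and \<alpha> \<beta> \<gamma> :: real
    and GV GU :: generators
    and Q Z :: "nat \<Rightarrow> real mat"
  defines "P \<equiv> quadratic_at \<alpha> \<beta> \<gamma> (A * the (mat_inverse B))"
  assumes "N \<ge> 3"
    and "(A, B) \<in> class_P N"
    and "V \<in> class_V N" "z \<in> carrier_vec N" "w \<in> carrier_vec N" "A = V - outer_prod z w"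
    and "U \<in> class_U N" "p \<in> carrier_vec N" "q \<in> carrier_vec N" "B = U - outer_prod p q"
    and "invertible_mat B"
    and "upper_triangular_generators N V GV"
    and "upper_quasiseparable_generators N U GU"
    and "double_shift_procedure N (input_of A B GV GU z w p q)
           (vec_first (P *\<^sub>v unit_vec N 0) 3) Q Z"
  shows "upper_hessenberg ((accumulate N Q)\<^sup>T * A * accumulate N Z) \<and>
         upper_triangular ((accumulate N Q)\<^sup>T * B * accumulate N Z) \<and>
         (\<exists>\<tau>. (accumulate N Q)\<^sup>T *\<^sub>v (P *\<^sub>v unit_vec N 0) = \<tau> \<cdot>\<^sub>v unit_vec N 0)"
proof -
  have A: "A \<in> carrier_mat N N" "upper_hessenberg A" and B: "B \<in> carrier_mat N N" "upper_triangular B"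
    using \<open>(A, B) \<in> class_P N\<close> by (auto simp: class_P_def class_H_def class_T_def)
  have V: "V \<in> carrier_mat N N" and U: "U \<in> carrier_mat N N"
    using \<open>V \<in> class_V N\<close> \<open>U \<in> class_U N\<close> by (auto simp: class_V_def class_U_def orth_matrix_carrier)
  let ?D = "input_of A B GV GU z w p q"
  obtain X where first: "first_Q (vec_first (P *\<^sub>v unit_vec N 0) 3) (Q 1)"
    and prepV: "prepare_V_A ?D (Q 1) X" and prepU: "prepare_U_B ?D X"
    and Z: "\<And>k. 1 \<le> k \<Longrightarrow> k \<le> N - 2 \<Longrightarrow> choose_Z ?D X k (Q k) (Z k)"
    and lastZ: "choose_last_Z N X (Q (N - 1)) (Z (N - 1))"
    and Q: "\<And>k. 1 \<le> k \<Longrightarrow> k \<le> N - 3 \<Longrightarrow> choose_Q ?D X k (Z k) (Q (k + 1))"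
    and lastQ: "choose_last_Q N ?D X (Z (N - 2)) (Q (N - 1))"
    and updU: "\<And>k. 1 \<le> k \<Longrightarrow> k \<le> N - 2 \<Longrightarrow> update_U_B ?D X k (Q k) (Z k)"
    and updV: "\<And>k. 1 \<le> k \<Longrightarrow> k \<le> N - 3 \<Longrightarrow> update_V_A ?D X k (Q (k + 1)) (Z k)"
    using \<open>double_shift_procedure N ?D _ Q Z\<close> unfolding double_shift_procedure_def by auto
  have rotZ: "rotation_sequence N Z"
  proof
    show "Z i \<in> carrier_mat 3 3" if "1 \<le> i" "i \<le> N - 2" for i
      using Z[OF that] by (auto simp: choose_Z_def Let_def intro: orth_matrix_carrier)
    show "Z (N - 1) \<in> carrier_mat 2 2"
      using lastZ by (auto simp: choose_last_Z_def Let_def intro: givens_rotation_carrier)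
  qed (rule \<open>N \<ge> 3\<close>)
  have rotQ: "rotation_sequence N Q"
  proof
    show "Q i \<in> carrier_mat 3 3" if "1 \<le> i" "i \<le> N - 2" for i
    proof (cases "i = 1")
      case True
      then show ?thesis using first by (auto simp: first_Q_def intro: orth_matrix_carrier)
    next
      case False
      then show ?thesis
        using Q[of "i - 1"] that by (auto simp: choose_Q_def Let_def intro: orth_matrix_carrier)
    qed
    show "Q (N - 1) \<in> carrier_mat 2 2"
      using lastQ by (auto simp: choose_last_Q_def Let_def intro: givens_rotation_carrier)
  qed (rule \<open>N \<ge> 3\<close>)
  obtain \<tau> where \<tau>: "(Q 1)\<^sup>T *\<^sub>v vec_first (P *\<^sub>v unit_vec N 0) 3 = vec_of_list [\<tau>, 0, 0]"
    using first by (auto simp: first_Q_def)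
  have "upper_hessenberg ((accumulate N Q)\<^sup>T * A * accumulate N Z)"
    using upper_hessenberg_result[OF _ A V _ _ _ _ refl rotQ rotZ prepV Q lastQ updV] assms by blast
  moreover have "upper_triangular ((accumulate N Q)\<^sup>T * B * accumulate N Z)"
    using upper_triangular_result[OF _ B U _ _ _ _ refl rotQ rotZ prepU Z lastZ updU] assms by blast
  moreover have "(accumulate N Q)\<^sup>T *\<^sub>v (P *\<^sub>v unit_vec N 0) = \<tau> \<cdot>\<^sub>v unit_vec N 0"
  proof (rule rotation_sequence.accumulate_transpose_mult_supported[OF rotQ _ _ \<tau>])
    note P = quadratic_first_column_support[where \<alpha> = \<alpha> and \<beta> = \<beta> and \<gamma> = \<gamma>,
        OF A B \<open>invertible_mat B\<close>, folded P_def]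
    show "P *\<^sub>v unit_vec N 0 \<in> carrier_vec N" using P(1) by simp
    show "(P *\<^sub>v unit_vec N 0) $ i = 0" if "3 \<le> i" "i < N" for i by (rule P(2)[OF that])
  qed
  ultimately show ?thesis by blast
qed

end
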